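(* Let $k$ be a field of characteristic zero, $n\geq 1$, $S=k[x_1,\ldots,x_n]$, and let $(S,L)$ be a triangularizable Lie–Rinehart algebra with universal enveloping algebra $U$. Then there is an isomorphism of $k$-vector spaces $\mathrm{HH}^0(U)\cong k$; that is, the center of $U$ is $k$.
   Context: A Lie–Rinehart algebra $(S,L)$ consists of a commutative $k$-algebra $S$, a $k$-Lie algebra $L$ with a left $S$-module structure and a Lie algebra map $L\to\operatorname{Der}(S)$, $\alpha\mapsto\alpha_S$, such that $(s\alpha)_S(t)=s\alpha_S(t)$ and $[\alpha,s\beta]=s[\alpha,\beta]+\alpha_S(s)\beta$ for $s,t\in S$, $\alpha,\beta\in L$. If $L\subseteq \operatorname{Der}(S)$ is simultaneously an $S$-submodule and a Lie subalgebra, then $(S,L)$ is a Lie–Rinehart algebra with $\alpha_S=\alpha$. Its universal enveloping algebra $U$ is the associative algebra equipped with an algebra map $i:S\to U$ and a Lie algebra map $j:L\to U$ satisfying $i(s)j(\alpha)=j(s\alpha)$ and $j(\alpha)i(s)-i(s)j(\alpha)=i(\alpha_S(s))$, universal with these properties. $(S,L)$ with $S=k[x_1,\ldots,x_n]$ and $L\subseteq\operatorname{Der}(S)$ is called triangularizable if $L$ is a free $S$-module with a basis $\alpha_1,\ldots,\alpha_n$ of derivations satisfying $\alpha_i(x_j)=0$ whenever $i>j$ and $\alpha_1(x_1)\cdots\alpha_n(x_n)\neq 0$. $\mathrm{HH}^0(U)=\operatorname{Ext}^0_{U\otimes U^{op}}(U,U)$ is the zeroth Hochschild cohomology, which is the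 center of $U$. *)

theory Defs
  imports "HOL-Library.Poly_Mapping" "HOL-Algebra.Ring" "HOL-Algebra.RingHom"
begin

text \<open>Polynomials over 'k in countably many variables; S = k[x_0,...,x_{n-1}] is the
subring of those only involving variables with index < n (0-indexed).\<close>

type_synonym 'k mpoly = "(nat \<Rightarrow>\<^sub>0 nat) \<Rightarrow>\<^sub>0 'k"

definition polys :: "nat \<Rightarrow> 'k::comm_ring_1 mpoly set" where
  "polys n = {p. \<forall>m \<in> Poly_Mapping.keys p. Poly_Mapping.keys m \<subseteq> {..<n}}"

definition Var :: "nat \<Rightarrow> 'k::comm_ring_1 mpoly" where
  "Var j = Poly_Mapping.single (Poly_Mapping.single j 1) 1"

definition Const :: "'k::comm_ring_1 \<Rightarrow> 'k mpoly" where
  "Const c = Poly_Mapping.single 0 c"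

definition poly_ring :: "nat \<Rightarrow> 'k::comm_ring_1 mpoly ring" where
  "poly_ring n = \<lparr>carrier = polys n, monoid.mult = (*), one = 1, zero = 0, add = (+)\<rparr>"

text \<open>k-derivations of S, represented extensionally (value 0 outside S).\<close>
definition is_derivation :: "nat \<Rightarrow> ('k::comm_ring_1 mpoly \<Rightarrow> 'k mpoly) \<Rightarrow> bool" where
  "is_derivation n D \<longleftrightarrow>
     (\<forall>p. p \<notin> polys n \<longrightarrow> D p = 0) \<and>
     (\<forall>p \<in> polys n. D p \<in> polys n) \<and>
     (\<forall>p \<in> polys n. \<forall>q \<in> polys n. D (p + q) = D p + D q) \<and>
     (\<forall>p \<in> polys n. \<forall>q \<in> polys n. D (p * q) = p * D q + q * D p) \<and>
     (\<forall>c. D (Const c) = 0)"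

definition der_smult :: "nat \<Rightarrow> 'k::comm_ring_1 mpoly \<Rightarrow> ('k mpoly \<Rightarrow> 'k mpoly) \<Rightarrow> ('k mpoly \<Rightarrow> 'k mpoly)" where
  "der_smult n s D = (\<lambda>p. if p \<in> polys n then s * D p else 0)"

definition der_bracket :: "('k::comm_ring_1 mpoly \<Rightarrow> 'k mpoly) \<Rightarrow> ('k mpoly \<Rightarrow> 'k mpoly) \<Rightarrow> ('k mpoly \<Rightarrow> 'k mpoly)" where
  "der_bracket D E = (\<lambda>p. D (E p) - E (D p))"

definition LR_subalgebra :: "nat \<Rightarrow> ('k::comm_ring_1 mpoly \<Rightarrow> 'k mpoly) set \<Rightarrow> bool" where
  "LR_subalgebra n L \<longleftrightarrow>
     (\<forall>D \<in> L. is_derivation n D) \<and> (\<lambda>_. 0) \<in> L \<and>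
     (\<forall>D \<in> L. \<forall>E \<in> L. (\<lambda>p. D p + E p) \<in> L) \<and>
     (\<forall>s \<in> polys n. \<forall>D \<in> L. der_smult n s D \<in> L) \<and>
     (\<forall>D \<in> L. \<forall>E \<in> L. der_bracket D E \<in> L)"

definition triangularizable :: "nat \<Rightarrow> ('k::comm_ring_1 mpoly \<Rightarrow> 'k mpoly) set \<Rightarrow> bool" where
  "triangularizable n L \<longleftrightarrow> LR_subalgebra n L \<and>
     (\<exists>\<alpha> :: nat \<Rightarrow> ('k mpoly \<Rightarrow> 'k mpoly).
        (\<forall>i < n. \<alpha> i \<in> L) \<and>
        (\<forall>D \<in> L. \<exists>!c :: nat \<Rightarrow> 'k mpoly.
            (\<forall>i. n \<le> i \<longrightarrow> c i = 0) \<and> (\<forall>i < n. c i \<in> polys n) \<and>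
            D = (\<lambda>p. \<Sum>i<n. der_smult n (c i) (\<alpha> i) p)) \<and>
        (\<forall>i < n. \<forall>j < n. j < i \<longrightarrow> \<alpha> i (Var j) = 0) \<and>
        (\<Prod>i<n. \<alpha> i (Var i)) \<noteq> 0)"

text \<open>(A, i, j) satisfies the defining relations of the universal enveloping algebra:
A is an (associative unital) ring, i : S \<rightarrow> A a ring map (this makes A a k-algebra via
i restricted to constants), j : L \<rightarrow> A a Lie ring map with i(s)j(a) = j(s a) and
j(a)i(s) - i(s)j(a) = i(a(s)).\<close>
definition LR_rep :: "nat \<Rightarrow> ('k::comm_ring_1 mpoly \<Rightarrow> 'k mpoly) set \<Rightarrow> 'a ring
     \<Rightarrow> ('k mpoly \<Rightarrow> 'a) \<Rightarrow> (('k mpoly \<Rightarrow> 'k mpoly) \<Rightarrow> 'a) \<Rightarrow> bool" where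
  "LR_rep n L A i j \<longleftrightarrow>
     ring A \<and> i \<in> ring_hom (poly_ring n) A \<and> j \<in> L \<rightarrow> carrier A \<and>
     (\<forall>D \<in> L. \<forall>E \<in> L. j (\<lambda>p. D p + E p) = j D \<oplus>\<^bsub>A\<^esub> j E) \<and>
     (\<forall>D \<in> L. \<forall>E \<in> L. j (der_bracket D E) = j D \<otimes>\<^bsub>A\<^esub> j E \<ominus>\<^bsub>A\<^esub> j E \<otimes>\<^bsub>A\<^esub> j D) \<and>
     (\<forall>s \<in> polys n. \<forall>D \<in> L. i s \<otimes>\<^bsub>A\<^esub> j D = j (der_smult n s D)) \<and>
     (\<forall>s \<in> polys n. \<forall>D \<in> L. j D \<otimes>\<^bsub>A\<^esub> i s \<ominus>\<^bsub>A\<^esub> i s \<otimes>\<^bsub>A\<^esub> j D = i (D s))"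

definition is_UEA :: "nat \<Rightarrow> ('k::comm_ring_1 mpoly \<Rightarrow> 'k mpoly) set \<Rightarrow> 'u ring
     \<Rightarrow> ('k mpoly \<Rightarrow> 'u) \<Rightarrow> (('k mpoly \<Rightarrow> 'k mpoly) \<Rightarrow> 'u) \<Rightarrow> bool" where
  "is_UEA n L U i j \<longleftrightarrow> LR_rep n L U i j \<and>
     (\<forall>(A :: ('u + 'k mpoly) ring) i' j'. LR_rep n L A i' j' \<longrightarrow>
        (\<exists>\<phi>. \<phi> \<in> ring_hom U A \<and> (\<forall>s \<in> polys n. \<phi> (i s) = i' s) \<and> (\<forall>D \<in> L. \<phi> (j D) = j' D)) \<and>
        (\<forall>\<phi> \<psi>. \<phi> \<in> ring_hom U A \<and> (\<forall>s \<in> polys n. \<phi> (i s) = i' s) \<and> (\<forall>D \<in> L. \<phi> (j D) = j' D) \<and>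
                \<psi> \<in> ring_hom U A \<and> (\<forall>s \<in> polys n. \<psi> (i s) = i' s) \<and> (\<forall>D \<in> L. \<psi> (j D) = j' D)
                \<longrightarrow> (\<forall>x \<in> carrier U. \<phi> x = \<psi> x)))"

definition ring_center :: "('a, 'b) ring_scheme \<Rightarrow> 'a set" where
  "ring_center R = {z \<in> carrier R. \<forall>x \<in> carrier R. z \<otimes>\<^bsub>R\<^esub> x = x \<otimes>\<^bsub>R\<^esub> z}"

end

theory Submission
  imports Defs "HOL-Algebra.Weak_Morphisms" "HOL-Algebra.Generated_Rings"
begin

text \<open>Let \<open>W\<^sub>k \<subseteq> U\<close> be the subring generated by \<open>S\<close> and \<open>\<alpha>\<^sub>k, \<alpha>\<^bsub>k+1\<^esub>, \<dots>\<close>. Triangularity gives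
  \<open>[\<alpha>\<^sub>k, \<alpha>\<^sub>l] \<in> W\<^bsub>k+1\<^esub> + S \<alpha>\<^sub>k\<close> for \<open>l > k\<close>, so every element of \<open>W\<^sub>k\<close> is a polynomial
  \<open>\<Sum>\<^sub>m w\<^sub>m \<alpha>\<^sub>k\<^sup>m\<close> with coefficients \<open>w\<^sub>m \<in> W\<^bsub>k+1\<^esub>\<close>. As \<open>x\<^sub>k\<close> commutes with \<open>W\<^bsub>k+1\<^esub>\<close>, taking the
  commutator with \<open>x\<^sub>k\<close> lowers the degree by one and turns the leading coefficient \<open>w\<^sub>d\<close> into
  \<open>d w\<^sub>d \<alpha>\<^sub>k(x\<^sub>k)\<close>. Downward induction on \<open>k\<close> shows that nonzero polynomials are not right zero
  divisors on \<open>W\<^sub>k\<close>; hence an element of \<open>W\<^sub>k\<close> commuting with \<open>x\<^sub>k\<close> lies in \<open>W\<^bsub>k+1\<^esub>\<close>. A central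
  element therefore lies in \<open>S\<close> and is killed by every \<open>\<alpha>\<^sub>k\<close>, so it is constant. The full PBW theorem
  is not needed: it suffices that \<open>S\<close> embeds into \<open>U\<close>, which follows from the action of \<open>U\<close> on \<open>S\<close>.\<close>

section \<open>Polynomials and derivations\<close>

lemma polys_add [intro]: "p \<in> polys n \<Longrightarrow> q \<in> polys n \<Longrightarrow> p + q \<in> polys n"
  using keys_add[of p q] unfolding polys_def by fastforce

lemma polys_mult [intro]:
  assumes "p \<in> polys n" "q \<in> polys n"
  shows "p * q \<in> polys n"
  unfolding polys_def
proof safe
  fix m l assume m: "m \<in> Poly_Mapping.keys (p * q)" and l: "l \<in> Poly_Mapping.keys m"
  from m obtain a b where "m = a + b" "a \<in> Poly_Mapping.keys p" "b \<in> Poly_Mapping.keys q"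
    using keys_mult[of p q] by blast
  then show "l < n"
    using l keys_add[of a b] assms unfolding polys_def by fastforce
qed

lemma polys_uminus [intro]: "p \<in> polys n \<Longrightarrow> - p \<in> polys n"
  by (simp add: polys_def)

lemma polys_single: "Poly_Mapping.keys e \<subseteq> {..<n} \<Longrightarrow> Poly_Mapping.single e c \<in> polys n"
  by (auto simp: polys_def)

lemma polys_Const [simp, intro]: "Const c \<in> polys n"
  by (simp add: Const_def polys_single)

lemma polys_Var [intro]: "l < n \<Longrightarrow> Var l \<in> polys n"
  by (simp add: Var_def polys_single)

lemma Const_0: "Const 0 = 0" and Const_1: "Const 1 = 1"
  by (simp_all add: Const_def)

lemma polys_0 [simp, intro]: "0 \<in> polys n" and polys_1 [simp, intro]: "1 \<in> polys n"
  by (simp_all flip: Const_0 Const_1)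

lemma polys_of_nat [simp, intro]: "of_nat k \<in> polys n"
  by (induction k) auto

lemma polys_sum [intro]: "(\<And>a. a \<in> A \<Longrightarrow> f a \<in> polys n) \<Longrightarrow> sum f A \<in> polys n"
  by (induction A rule: infinite_finite_induct) auto

lemma polys_0_eq_Const:
  assumes "p \<in> polys 0"
  shows "p \<in> range Const"
proof
  have "Poly_Mapping.lookup p e = 0" if "e \<noteq> 0" for e
    using assms that by (auto simp: polys_def in_keys_iff)
  then show "p = Const (Poly_Mapping.lookup p 0)"
    by (intro poly_mapping_eqI) (auto simp: Const_def lookup_single when_def)
qed simp

lemma derivation_0: "is_derivation n D \<Longrightarrow> D 0 = 0"
  unfolding is_derivation_def by (metis Const_0)

lemma derivation_sum:
  assumes "is_derivation n D" and "\<And>a. a \<in> A \<Longrightarrow> f a \<in> polys n"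
  shows "D (sum f A) = (\<Sum>a\<in>A. D (f a))"
  using assms(2)
proof (induction A rule: infinite_finite_induct)
  case (insert x F)
  then show ?case
    using assms(1) polys_sum[of F f n] by (simp add: is_derivation_def)
qed (simp_all add: derivation_0[OF assms(1)])

text \<open>On \<open>k[x\<^sub>0, \<dots>, x\<^sub>m]\<close>, a derivation killing \<open>x\<^sub>0, \<dots>, x\<^bsub>m-1\<^esub>\<close> is a multiple of
  \<open>\<partial>/\<partial>x\<^sub>m\<close>. When the exponent of \<open>x\<^sub>m\<close> is \<open>0\<close>, the truncated subtraction is harmless.\<close>

lemma derivation_monomial:
  fixes D :: "'k::comm_ring_1 mpoly \<Rightarrow> 'k mpoly"
  assumes D: "is_derivation n D" and "m < n" and D0: "\<And>l. l < m \<Longrightarrow> D (Var l) = 0"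
    and e: "Poly_Mapping.keys e \<subseteq> {..m}"
  shows "D (Poly_Mapping.single e 1) = of_nat (Poly_Mapping.lookup e m)
    * Poly_Mapping.single (e - Poly_Mapping.single m 1) 1 * D (Var m)"
  using e
\<comment> \<open>Induction on the total degree of \<open>e\<close>: one variable \<open>x_l\<close>
  occurring in \<open>e\<close> is split off, and the Leibniz rule is applied to the product of
  \<open>x_l\<close> and the remaining monomial \<open>e'\<close>.\<close>
proof (induction "\<Sum>l\<le>m. Poly_Mapping.lookup e l" arbitrary: e)
  case 0
  then have "Poly_Mapping.lookup e l = 0" for l
    by (cases "l \<le> m") (auto simp: in_keys_iff subset_iff)
  then have "e = 0"
    by (intro poly_mapping_eqI) simp
  moreover have "D 1 = 0"
    using D by (metis Const_1 is_derivation_def)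
  ultimately show ?case by simp
next
  case (Suc N)
  have "(\<Sum>l\<le>m. Poly_Mapping.lookup e l) \<noteq> 0"
    using Suc.hyps(2) by linarith
  then obtain l where l: "l \<le> m" "Poly_Mapping.lookup e l \<noteq> 0"
    by (metis (no_types, lifting) atMost_iff sum.neutral)
  define e' where "e' = e - Poly_Mapping.single l 1"
  have ee': "e = Poly_Mapping.single l 1 + e'"
    using l by (intro poly_mapping_eqI) (auto simp: e'_def lookup_add lookup_minus lookup_single when_def)
  have lk: "Poly_Mapping.lookup e q = Poly_Mapping.lookup e' q + (if q = l then 1 else 0)" for q
    by (simp add: ee' lookup_add lookup_single)
  have N: "N = (\<Sum>q\<le>m. Poly_Mapping.lookup e' q)"
    using Suc.hyps(2) l(1) by (simp add: lk sum.distrib)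
  have ke': "Poly_Mapping.keys e' \<subseteq> {..m}"
    using Suc.prems lk by (auto simp: in_keys_iff subset_iff)
  note IH = Suc.hyps(1)[OF N ke']
  have mon: "Poly_Mapping.single e (1::'k) = Var l * Poly_Mapping.single e' 1"
    by (simp add: Var_def mult_single ee')
  have "(Var l :: 'k mpoly) \<in> polys n" "Poly_Mapping.single e' (1::'k) \<in> polys n"
    using l \<open>m < n\<close> ke' by (auto intro!: polys_single)
  then have De: "D (Poly_Mapping.single e 1)
      = Var l * D (Poly_Mapping.single e' 1) + Poly_Mapping.single e' 1 * D (Var l)"
    unfolding mon using D by (simp add: is_derivation_def)
  have e'_eq: "l = m \<Longrightarrow> e - Poly_Mapping.single m 1 = e'"
    by (simp add: e'_def)
  show ?case
  proof (cases "Poly_Mapping.lookup e' m = 0")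
    case True
    then show ?thesis
      unfolding De IH lk[of m] using D0[of l] l e'_eq by (cases "l = m") (simp_all del: One_nat_def)
  next
    case False
    \<comment> \<open>Here \<open>x_m\<close> occurs in \<open>e'\<close>, so the subtraction is not
      truncated and multiplying by \<open>x_l\<close> commutes with lowering the exponent of
      \<open>x_m\<close>.\<close>
    have "Var l * Poly_Mapping.single (e' - Poly_Mapping.single m 1) (1::'k)
        = Poly_Mapping.single (Poly_Mapping.single l 1 + (e' - Poly_Mapping.single m 1)) 1"
      by (simp add: Var_def mult_single)
    also have "Poly_Mapping.single l 1 + (e' - Poly_Mapping.single m 1) = e - Poly_Mapping.single m 1"
      using False by (intro poly_mapping_eqI)
        (auto simp: ee' lookup_add lookup_minus lookup_single when_def)
    finally have V: "Var l * Poly_Mapping.single (e' - Poly_Mapping.single m 1) (1::'k)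
        = Poly_Mapping.single (e - Poly_Mapping.single m 1) 1" .
    have "Var l * D (Poly_Mapping.single e' 1) = of_nat (Poly_Mapping.lookup e' m)
        * Poly_Mapping.single (e - Poly_Mapping.single m 1) 1 * D (Var m)"
      unfolding IH V[symmetric] by (simp add: mult_ac)
    then show ?thesis
      unfolding De lk[of m] using D0[of l] l e'_eq
      by (cases "l = m") (simp_all add: algebra_simps del: One_nat_def)
  qed
qed

text \<open>On \<open>polys (Suc m)\<close> the derivation is \<open>D (Var m)\<close> times the
  formal partial derivative in \<open>x_m\<close>, which is \<open>?q\<close> in the proof.
  Polynomials form a domain, so \<open>D p = 0\<close> forces \<open>?q = 0\<close>, and in
  characteristic zero \<open>p\<close> cannot then involve \<open>x_m\<close>.\<close>

lemma derivation_kernel: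
  fixes D :: "'k::field_char_0 mpoly \<Rightarrow> 'k mpoly"
  assumes D: "is_derivation n D" and "m < n" and D0: "\<And>l. l < m \<Longrightarrow> D (Var l) = 0"
    and Dm: "D (Var m) \<noteq> 0" and p: "p \<in> polys (Suc m)" and Dp: "D p = 0"
  shows "p \<in> polys m"
proof -
  let ?x = "Poly_Mapping.single m (1::nat)"
  let ?lk = "\<lambda>e. Poly_Mapping.lookup p e * of_nat (Poly_Mapping.lookup e m)"
  let ?q = "\<Sum>e\<in>Poly_Mapping.keys p. Poly_Mapping.single (e - ?x) (?lk e)"
  have ke: "Poly_Mapping.keys e \<subseteq> {..m}" if "e \<in> Poly_Mapping.keys p" for e
    using p that by (force simp: polys_def)
  have kn: "Poly_Mapping.single e (1::'k) \<in> polys n" if "e \<in> Poly_Mapping.keys p" for e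
    using ke[OF that] \<open>m < n\<close> by (auto intro!: polys_single)
  have Dmon: "D (Poly_Mapping.single e (Poly_Mapping.lookup p e)) = Poly_Mapping.single (e - ?x) (?lk e) * D (Var m)"
    if "e \<in> Poly_Mapping.keys p" for e
  proof -
    have "Poly_Mapping.single e (Poly_Mapping.lookup p e) = Const (Poly_Mapping.lookup p e) * Poly_Mapping.single e 1"
      by (simp add: Const_def mult_single)
    then have "D (Poly_Mapping.single e (Poly_Mapping.lookup p e)) = Const (Poly_Mapping.lookup p e) * D (Poly_Mapping.single e 1)"
      using D kn[OF that] by (simp add: is_derivation_def)
    also have "\<dots> = Const (Poly_Mapping.lookup p e) * (Poly_Mapping.single 0 (of_nat (Poly_Mapping.lookup e m))
        * Poly_Mapping.single (e - ?x) 1 * D (Var m))"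
      by (simp only: single_of_nat derivation_monomial[OF D \<open>m < n\<close> D0 ke[OF that]])
    finally show ?thesis
      by (simp add: Const_def mult_single mult.assoc[symmetric] del: single_of_nat)
  qed
  have "p = (\<Sum>e\<in>Poly_Mapping.keys p. Poly_Mapping.single e (Poly_Mapping.lookup p e))"
    by (intro poly_mapping_eqI) (simp add: lookup_sum lookup_single when_def in_keys_iff)
  then have "D p = (\<Sum>e\<in>Poly_Mapping.keys p. D (Poly_Mapping.single e (Poly_Mapping.lookup p e)))"
    using ke \<open>m < n\<close> by (subst derivation_sum[OF D, symmetric]) (fastforce intro!: polys_single)+
  also have "\<dots> = ?q * D (Var m)"
    by (simp add: Dmon sum_distrib_right)
  finally have q: "?q = 0"
    using Dm Dp by simp
  have "Poly_Mapping.lookup e m = 0" if e: "e \<in> Poly_Mapping.keys p" for e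
  proof (rule ccontr)
    assume em: "Poly_Mapping.lookup e m \<noteq> 0"
    \<comment> \<open>Truncated subtraction can only identify \<open>e'\<close> with
      \<open>e\<close> if \<open>x_m\<close> is missing from \<open>e'\<close>; such terms have
      coefficient \<open>?lk e' = 0\<close>. So the coefficient of \<open>?q\<close> at
      \<open>e - ?x\<close> is exactly \<open>?lk e\<close>.\<close>
    have inj: "e' - ?x \<noteq> e - ?x" if "e' \<noteq> e" "Poly_Mapping.lookup e' m \<noteq> 0" for e'
    proof
      assume eq: "e' - ?x = e - ?x"
      have "Poly_Mapping.lookup e' l = Poly_Mapping.lookup e l" for l
        using arg_cong[OF eq, of "\<lambda>a. Poly_Mapping.lookup a l"] that em
        by (cases "l = m") (auto simp: lookup_minus lookup_single when_def)
      then show False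
        using that poly_mapping_eqI by blast
    qed
    have "0 = Poly_Mapping.lookup ?q (e - ?x)"
      by (simp only: q lookup_zero)
    also have "\<dots> = (\<Sum>e'\<in>Poly_Mapping.keys p. if e' = e then ?lk e' else 0)"
      unfolding lookup_sum using inj
      by (intro sum.cong) (auto simp: lookup_single when_def)
    also have "\<dots> = ?lk e"
      using e by simp
    finally show False
      using e em by (simp add: in_keys_iff)
  qed
  then have "m \<notin> Poly_Mapping.keys e" if "e \<in> Poly_Mapping.keys p" for e
    using that by (simp add: in_keys_iff)
  then have "Poly_Mapping.keys e \<subseteq> {..<m}" if "e \<in> Poly_Mapping.keys p" for e
    using ke[OF that] that by (metis atMost_iff lessThan_iff order_le_less subset_iff)
  then show ?thesis
    by (simp add: polys_def)
qed

section \<open>Representations and the universal property\<close>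

lemma LR_repD:
  assumes "LR_rep n L A i j"
  shows "ring A" "i \<in> ring_hom (poly_ring n) A"
    "s \<in> polys n \<Longrightarrow> i s \<in> carrier A" "D \<in> L \<Longrightarrow> j D \<in> carrier A"
    "\<lbrakk>D \<in> L; E \<in> L\<rbrakk> \<Longrightarrow> j (\<lambda>p. D p + E p) = j D \<oplus>\<^bsub>A\<^esub> j E"
    "\<lbrakk>D \<in> L; E \<in> L\<rbrakk> \<Longrightarrow> j (der_bracket D E) = j D \<otimes>\<^bsub>A\<^esub> j E \<ominus>\<^bsub>A\<^esub> j E \<otimes>\<^bsub>A\<^esub> j D"
    "\<lbrakk>s \<in> polys n; D \<in> L\<rbrakk> \<Longrightarrow> i s \<otimes>\<^bsub>A\<^esub> j D = j (der_smult n s D)"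
    "\<lbrakk>s \<in> polys n; D \<in> L\<rbrakk> \<Longrightarrow> j D \<otimes>\<^bsub>A\<^esub> i s \<ominus>\<^bsub>A\<^esub> i s \<otimes>\<^bsub>A\<^esub> j D = i (D s)"
proof -
  show "s \<in> polys n \<Longrightarrow> i s \<in> carrier A"
    using assms ring_hom_closed[of i "poly_ring n" A s] by (simp add: LR_rep_def poly_ring_def)
qed (use assms in \<open>unfold LR_rep_def, blast+\<close>)

lemma LR_rep_hom:
  fixes L :: "('k::comm_ring_1 mpoly \<Rightarrow> 'k mpoly) set"
  assumes rep: "LR_rep n L A i j" and B: "ring B" and h: "h \<in> ring_hom A B"
  shows "LR_rep n L B (h \<circ> i) (h \<circ> j)"
proof -
  interpret A: ring A by (rule LR_repD(1)[OF rep])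
  interpret h: ring_hom_ring A B h
    by (rule ring_hom_ringI2[OF A.ring_axioms B h])
  have sub: "h (x \<ominus>\<^bsub>A\<^esub> y) = h x \<ominus>\<^bsub>B\<^esub> h y" if "x \<in> carrier A" "y \<in> carrier A" for x y
    using that by (simp add: a_minus_def)
  note R = LR_repD[OF rep]
  show ?thesis
    unfolding LR_rep_def
  proof (intro conjI ballI B)
    show "h \<circ> i \<in> ring_hom (poly_ring n) B"
      by (rule ring_hom_trans[OF R(2) h])
    show "h \<circ> j \<in> L \<rightarrow> carrier B"
      using R(4) by auto
  next
    fix D E assume "D \<in> L" "E \<in> L"
    then show "(h \<circ> j) (\<lambda>p. D p + E p) = (h \<circ> j) D \<oplus>\<^bsub>B\<^esub> (h \<circ> j) E"
      "(h \<circ> j) (der_bracket D E) =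
        (h \<circ> j) D \<otimes>\<^bsub>B\<^esub> (h \<circ> j) E \<ominus>\<^bsub>B\<^esub> (h \<circ> j) E \<otimes>\<^bsub>B\<^esub> (h \<circ> j) D"
      using R(4-6) by (simp_all add: sub)
  next
    fix s :: "'k mpoly" and D assume sD: "s \<in> polys n" "D \<in> L"
    then show "(h \<circ> i) s \<otimes>\<^bsub>B\<^esub> (h \<circ> j) D = (h \<circ> j) (der_smult n s D)"
      by (simp add: R(3,4) flip: R(7))
    show "(h \<circ> j) D \<otimes>\<^bsub>B\<^esub> (h \<circ> i) s \<ominus>\<^bsub>B\<^esub> (h \<circ> i) s \<otimes>\<^bsub>B\<^esub> (h \<circ> j) D = (h \<circ> i) (D s)"
      using sD by (simp add: R(3,4) sub flip: R(8))
  qed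
qed

lemma LR_rep_subring:
  fixes L :: "('k::comm_ring_1 mpoly \<Rightarrow> 'k mpoly) set"
  assumes rep: "LR_rep n L A i j" and K: "subring K A"
    and i: "i ` polys n \<subseteq> K" and j: "j ` L \<subseteq> K"
  shows "LR_rep n L (A\<lparr>carrier := K\<rparr>) i j"
proof -
  interpret A: ring A by (rule LR_repD(1)[OF rep])
  let ?K = "A\<lparr>carrier := K\<rparr>"
  interpret K: ring ?K by (rule A.subring_is_ring[OF K])
  have KA: "K \<subseteq> carrier A" by (rule subringE(1)[OF K])
  interpret h: ring_hom_ring ?K A "\<lambda>x. x"
    by (rule ring_hom_ringI2[OF K.ring_axioms A.ring_axioms]) (use KA in \<open>auto simp: ring_hom_def\<close>)
  \<comment> \<open>The additive inverse in \<open>?K\<close> is chosen relative to the carrier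
    \<open>K\<close>. That it agrees with the inverse in \<open>A\<close> comes from the inclusion
    being a homomorphism.\<close>
  have sub: "x \<otimes>\<^bsub>A\<^esub> y \<ominus>\<^bsub>?K\<^esub> z \<otimes>\<^bsub>A\<^esub> w = x \<otimes>\<^bsub>A\<^esub> y \<ominus>\<^bsub>A\<^esub> z \<otimes>\<^bsub>A\<^esub> w"
    if "x \<in> K" "y \<in> K" "z \<in> K" "w \<in> K" for x y z w
    using that h.hom_a_inv[of "z \<otimes>\<^bsub>A\<^esub> w"] by (simp add: a_minus_def subringE(6)[OF K])
  have iK: "i s \<in> K" if "s \<in> polys n" for s using i that by blast
  have jK: "j D \<in> K" if "D \<in> L" for D using j that by blast
  note R = LR_repD[OF rep]
  show ?thesis
    unfolding LR_rep_def
  proof (intro conjI ballI K.ring_axioms)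
    show "i \<in> ring_hom (poly_ring n) ?K"
      using R(2) iK by (auto simp: ring_hom_def poly_ring_def)
    show "j \<in> L \<rightarrow> carrier ?K"
      using jK by simp
  next
    fix D E assume "D \<in> L" "E \<in> L"
    then show "j (\<lambda>p. D p + E p) = j D \<oplus>\<^bsub>?K\<^esub> j E"
      "j (der_bracket D E) = j D \<otimes>\<^bsub>?K\<^esub> j E \<ominus>\<^bsub>?K\<^esub> j E \<otimes>\<^bsub>?K\<^esub> j D"
      using R(5,6) by (simp_all add: sub jK)
  next
    fix s :: "'k mpoly" and D assume sD: "s \<in> polys n" "D \<in> L"
    then show "i s \<otimes>\<^bsub>?K\<^esub> j D = j (der_smult n s D)"
      using R(7) by simp
    have "j D \<otimes>\<^bsub>A\<^esub> i s \<ominus>\<^bsub>?K\<^esub> i s \<otimes>\<^bsub>A\<^esub> j D = i (D s)"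
      using R(8)[OF sD] by (simp only: sub jK[OF sD(2)] iK[OF sD(1)])
    then show "j D \<otimes>\<^bsub>?K\<^esub> i s \<ominus>\<^bsub>?K\<^esub> i s \<otimes>\<^bsub>?K\<^esub> j D = i (D s)"
      by simp
  qed
qed

text \<open>This carries a representation over to another type. The universal property in
  \<open>is_UEA\<close> speaks only of rings on \<open>'u + 'k mpoly\<close>, so every target must
  first be copied there.\<close>

lemma LR_rep_image_ring:
  assumes rep: "LR_rep n L A i j" and f: "inj_on f (carrier A)"
  shows "LR_rep n L (image_ring f A) (f \<circ> i) (f \<circ> j)"
proof (rule LR_rep_hom[OF rep])
  interpret A: ring A by (rule LR_repD(1)[OF rep])
  show "ring (image_ring f A)"
    by (rule A.inj_imp_image_ring_is_ring[OF f])
  show "f \<in> ring_hom A (image_ring f A)"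
    using inj_imp_image_ring_iso[OF f] by (simp add: ring_iso_def)
qed

lemma is_UEAD:
  fixes U :: "'u ring" and A :: "('u + 'k::comm_ring_1 mpoly) ring"
    and L :: "('k mpoly \<Rightarrow> 'k mpoly) set"
  assumes "is_UEA n L U i j" "LR_rep n L A i' j'"
  shows "\<exists>\<phi>\<in>ring_hom U A. (\<forall>s\<in>polys n. \<phi> (i s) = i' s) \<and> (\<forall>D\<in>L. \<phi> (j D) = j' D)"
    and "\<lbrakk>\<phi> \<in> ring_hom U A; \<forall>s\<in>polys n. \<phi> (i s) = i' s; \<forall>D\<in>L. \<phi> (j D) = j' D;
      \<psi> \<in> ring_hom U A; \<forall>s\<in>polys n. \<psi> (i s) = i' s; \<forall>D\<in>L. \<psi> (j D) = j' D; x \<in> carrier U\<rbrakk>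
      \<Longrightarrow> \<phi> x = \<psi> x"
proof -
  note * = assms(1)[unfolded is_UEA_def, THEN conjunct2, THEN spec, THEN spec, THEN spec,
      THEN mp, OF assms(2)]
  from *[THEN conjunct1]
  show "\<exists>\<phi>\<in>ring_hom U A. (\<forall>s\<in>polys n. \<phi> (i s) = i' s) \<and> (\<forall>D\<in>L. \<phi> (j D) = j' D)"
    by blast
  show "\<phi> x = \<psi> x" if "\<phi> \<in> ring_hom U A" "\<forall>s\<in>polys n. \<phi> (i s) = i' s" "\<forall>D\<in>L. \<phi> (j D) = j' D"
      "\<psi> \<in> ring_hom U A" "\<forall>s\<in>polys n. \<psi> (i s) = i' s" "\<forall>D\<in>L. \<psi> (j D) = j' D" "x \<in> carrier U"
    using *[THEN conjunct2, THEN spec, THEN spec, THEN mp, of \<phi> \<psi>] that by simp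
qed

text \<open>The universal property gives a map from \<open>U\<close> to the subring
  \<open>?K\<close> generated by the images of \<open>i\<close> and \<open>j\<close>. Followed by
  the inclusion into \<open>U\<close> it agrees with the identity on generators, so by uniqueness it
  is the identity, and \<open>U\<close> lies in \<open>?K\<close>. All targets are copies along
  \<open>Inl\<close>.\<close>

lemma UEA_generated:
  fixes U :: "'u ring" and L :: "('k::comm_ring_1 mpoly \<Rightarrow> 'k mpoly) set"
  assumes uea: "is_UEA n L U i j"
  shows "carrier U = generate_ring U (i ` polys n \<union> j ` L)"
proof
  have rep: "LR_rep n L U i j"
    using uea by (simp add: is_UEA_def)
  interpret U: ring U by (rule LR_repD(1)[OF rep])
  let ?H = "i ` polys n \<union> j ` L"
  let ?K = "generate_ring U ?H"
  let ?h = "Inl :: 'u \<Rightarrow> 'u + 'k mpoly"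
  have H: "?H \<subseteq> carrier U"
    using LR_repD(3,4)[OF rep] by auto
  show "?K \<subseteq> carrier U"
    by (rule U.generate_ring_incl[OF H])
  have K: "subring ?K U"
    by (rule U.generate_ring_is_subring[OF H])
  have inj: "inj_on ?h X" for X
    by simp
  have repK: "LR_rep n L (U\<lparr>carrier := ?K\<rparr>) i j"
    by (rule LR_rep_subring[OF rep K]) (auto intro: generate_ring.incl)
  have repB: "LR_rep n L (image_ring ?h U) (?h \<circ> i) (?h \<circ> j)"
    by (rule LR_rep_image_ring[OF rep inj])
  obtain \<phi> where \<phi>: "\<phi> \<in> ring_hom U (image_ring ?h (U\<lparr>carrier := ?K\<rparr>))"
    "\<forall>s\<in>polys n. \<phi> (i s) = (?h \<circ> i) s" "\<forall>D\<in>L. \<phi> (j D) = (?h \<circ> j) D"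
    using is_UEAD(1)[OF uea LR_rep_image_ring[OF repK inj]] by blast
  have "\<phi> \<in> ring_hom U (image_ring ?h U)"
  proof -
    \<comment> \<open>The two image rings pull their arguments back by \<open>inv_into\<close> with
      different carriers. On values of \<open>\<phi>\<close> both pullbacks give the same element,
      so the operations agree there.\<close>
    have inv: "inv_into ?K ?h (\<phi> x) = inv_into (carrier U) ?h (\<phi> x)" if x: "x \<in> carrier U" for x
    proof -
      obtain a where "a \<in> ?K" "\<phi> x = ?h a"
        using ring_hom_closed[OF \<phi>(1) x] by (auto simp: image_ring_carrier)
      then show ?thesis
        using \<open>?K \<subseteq> carrier U\<close> by (simp add: subset_iff)
    qed
    show ?thesis
      using \<phi>(1) \<open>?K \<subseteq> carrier U\<close>
      by (fastforce simp: ring_hom_def image_ring_def image_group_def monoid.defs Pi_iff inv)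
  qed
  moreover have "?h \<in> ring_hom U (image_ring ?h U)"
    using inj_imp_image_ring_iso[OF inj, of U] by (simp add: ring_iso_def)
  ultimately have eq: "\<phi> x = ?h x" if "x \<in> carrier U" for x
    using is_UEAD(2)[OF uea repB _ \<phi>(2,3)] that by simp
  show "carrier U \<subseteq> ?K"
  proof
    fix x assume "x \<in> carrier U"
    then show "x \<in> ?K"
      using eq ring_hom_closed[OF \<phi>(1)] by (auto simp: image_ring_carrier)
  qed
qed

section \<open>Cardinality of generated rings\<close>

lemma card_of_Un_le:
  includes cardinal_syntax
  assumes "infinite C" "|A| \<le>o |C|" "|B| \<le>o |C|"
  shows "|A \<union> B| \<le>o |C|"
  using assms by (intro card_of_Un_ordLeq_infinite_Field card_of_Card_order) (simp_all add: Field_card_of)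

lemma card_of_Times_le:
  includes cardinal_syntax
  assumes "infinite C" "|A| \<le>o |C|" "|B| \<le>o |C|"
  shows "|A \<times> B| \<le>o |C|"
  using assms by (intro card_of_Times_ordLeq_infinite_Field card_of_Card_order) (simp_all add: Field_card_of)


text \<open>The generated ring is exhausted by countably many stages \<open>X m\<close>, each
  obtained from the previous one by applying every ring operation once. An infinite cardinal bound
  survives squares, images, finite unions and countable unions.\<close>

lemma card_of_generate_ring:
  includes cardinal_syntax
  fixes R :: "('a, 'b) ring_scheme"
  assumes A: "infinite A" and H: "|H| \<le>o |A|"
  shows "|generate_ring R H| \<le>o |A|"
proof -
  define step where "step Y = Y \<union> a_inv R ` Y \<union> (\<lambda>(x, y). x \<oplus>\<^bsub>R\<^esub> y) ` (Y \<times> Y)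
    \<union> (\<lambda>(x, y). x \<otimes>\<^bsub>R\<^esub> y) ` (Y \<times> Y)" for Y
  define X where "X m = (step ^^ m) (insert \<one>\<^bsub>R\<^esub> H)" for m
  have X_Suc: "X (Suc m) = step (X m)" for m
    by (simp add: X_def)
  have "|X m| \<le>o |A|" for m
  proof (induction m)
    case 0
    have "|{\<one>\<^bsub>R\<^esub>}| \<le>o |A|"
      by (rule card_of_singl_ordLeq) (use A in auto)
    then have "|{\<one>\<^bsub>R\<^esub>} \<union> H| \<le>o |A|"
      by (intro card_of_Un_le A H)
    then show ?case
      by (simp add: X_def)
  next
    case (Suc m)
    have "|X m \<times> X m| \<le>o |A|"
      by (intro card_of_Times_le A Suc)
    then have "|f ` (X m \<times> X m)| \<le>o |A|" for f :: "_ \<Rightarrow> 'a"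
      by (rule ordLeq_transitive[OF card_of_image])
    moreover have "|a_inv R ` X m| \<le>o |A|"
      by (rule ordLeq_transitive[OF card_of_image Suc])
    ultimately show ?case
      unfolding X_Suc step_def by (intro card_of_Un_le A Suc)
  qed
  then have "|\<Union>m. X m| \<le>o |A|"
    by (intro card_of_UNION_ordLeq_infinite A) (use A in \<open>auto simp: infinite_iff_card_of_nat\<close>)
  moreover have "generate_ring R H \<subseteq> (\<Union>m. X m)"
  proof
    have "mono X"
      by (rule mono_iff_le_Suc[THEN iffD2]) (auto simp: X_Suc step_def)
    then have both: "\<exists>m. x \<in> X m \<and> y \<in> X m" if "x \<in> X k" "y \<in> X l" for x y k l
      using that monoD[of X k "max k l"] monoD[of X l "max k l"] by (auto intro!: exI[of _ "max k l"])
    fix x assume "x \<in> generate_ring R H"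
    then show "x \<in> (\<Union>m. X m)"
    proof induction
      case one
      then show ?case by (auto simp: X_def intro!: exI[of _ 0])
    next
      case (incl h)
      then show ?case by (auto simp: X_def intro!: exI[of _ 0])
    next
      case (a_inv h)
      then obtain m where "h \<in> X m" by blast
      then have "\<ominus>\<^bsub>R\<^esub> h \<in> X (Suc m)" by (simp add: X_Suc step_def)
      then show ?case by blast
    next
      case (eng_add h1 h2)
      then obtain m where "h1 \<in> X m" "h2 \<in> X m" using both by blast
      then have "h1 \<oplus>\<^bsub>R\<^esub> h2 \<in> X (Suc m)" by (force simp: X_Suc step_def)
      then show ?case by blast
    next
      case (eng_mult h1 h2)
      then obtain m where "h1 \<in> X m" "h2 \<in> X m" using both by blast
      then have "h1 \<otimes>\<^bsub>R\<^esub> h2 \<in> X (Suc m)" by (force simp: X_Suc step_def)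
      then show ?case by blast
    qed
  qed
  ultimately show ?thesis
    using card_of_mono1 ordLeq_transitive by blast
qed

section \<open>The action on S by additive endomorphisms\<close>

text \<open>Maps vanish outside \<open>polys n\<close>, the convention of
  \<open>is_derivation\<close>, so that derivations are literally elements of this ring and ring
  equality is equality of functions. For the same reason the unit is the identity cut off outside
  \<open>polys n\<close>.\<close>

definition End_ring :: "nat \<Rightarrow> ('k::comm_ring_1 mpoly \<Rightarrow> 'k mpoly) ring" where
  "End_ring n = \<lparr>carrier = {F. (\<forall>p. p \<notin> polys n \<longrightarrow> F p = 0) \<and> (\<forall>p\<in>polys n. F p \<in> polys n) \<and>
      (\<forall>p\<in>polys n. \<forall>q\<in>polys n. F (p + q) = F p + F q)},
    monoid.mult = (\<circ>), one = (\<lambda>p. if p \<in> polys n then p else 0),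
    zero = (\<lambda>_. 0), add = (\<lambda>F G p. F p + G p)\<rparr>"

definition mult_op :: "nat \<Rightarrow> 'k::comm_ring_1 mpoly \<Rightarrow> 'k mpoly \<Rightarrow> 'k mpoly" where
  "mult_op n s = (\<lambda>p. if p \<in> polys n then s * p else 0)"

text \<open>Outside \<open>polys n\<close> a composite of \<open>F\<close> with another element
  takes the value \<open>F 0\<close>, so closure under composition rests on this.\<close>

lemma End_ring_0: "F \<in> carrier (End_ring n) \<Longrightarrow> F 0 = 0"
  unfolding End_ring_def by simp (metis add_0 add_cancel_right_left polys_0)

lemma End_ring_uminus:
  "F \<in> carrier (End_ring n) \<Longrightarrow> (\<lambda>p. - F p) \<in> carrier (End_ring n)"
  by (auto simp: End_ring_def)

lemma ring_End_ring: "ring (End_ring n :: ('k::comm_ring_1 mpoly \<Rightarrow> 'k mpoly) ring)"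
proof (rule ringI)
  show "abelian_group (End_ring n :: ('k mpoly \<Rightarrow> 'k mpoly) ring)"
  proof (rule abelian_groupI)
    fix F :: "'k mpoly \<Rightarrow> 'k mpoly" assume F: "F \<in> carrier (End_ring n)"
    show "\<exists>G\<in>carrier (End_ring n). G \<oplus>\<^bsub>End_ring n\<^esub> F = \<zero>\<^bsub>End_ring n\<^esub>"
      by (rule bexI[OF _ End_ring_uminus[OF F]]) (simp add: End_ring_def)
  qed (auto simp: End_ring_def algebra_simps)
  show "Group.monoid (End_ring n :: ('k mpoly \<Rightarrow> 'k mpoly) ring)"
  proof (rule monoidI)
    fix F G :: "'k mpoly \<Rightarrow> 'k mpoly"
    assume F: "F \<in> carrier (End_ring n)" and "G \<in> carrier (End_ring n)"
    then show "F \<otimes>\<^bsub>End_ring n\<^esub> G \<in> carrier (End_ring n)"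
      using End_ring_0[OF F] by (auto simp: End_ring_def)
  next
    fix F :: "'k mpoly \<Rightarrow> 'k mpoly" assume F: "F \<in> carrier (End_ring n)"
    show "F \<otimes>\<^bsub>End_ring n\<^esub> \<one>\<^bsub>End_ring n\<^esub> = F"
      using F End_ring_0[OF F] by (auto simp: End_ring_def fun_eq_iff)
    show "\<one>\<^bsub>End_ring n\<^esub> \<otimes>\<^bsub>End_ring n\<^esub> F = F"
      using F End_ring_0[OF F] by (auto simp: End_ring_def fun_eq_iff)
  qed (auto simp: End_ring_def)
next
  fix F G H :: "'k mpoly \<Rightarrow> 'k mpoly"
  assume "F \<in> carrier (End_ring n)" "G \<in> carrier (End_ring n)" and H: "H \<in> carrier (End_ring n)"
  then show "H \<otimes>\<^bsub>End_ring n\<^esub> (F \<oplus>\<^bsub>End_ring n\<^esub> G)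
      = H \<otimes>\<^bsub>End_ring n\<^esub> F \<oplus>\<^bsub>End_ring n\<^esub> H \<otimes>\<^bsub>End_ring n\<^esub> G"
    using End_ring_0[OF H] by (simp add: End_ring_def fun_eq_iff) (metis add.right_neutral)
qed (auto simp: End_ring_def)

lemma End_ring_minus:
  fixes F G :: "'k::comm_ring_1 mpoly \<Rightarrow> 'k mpoly"
  assumes F: "F \<in> carrier (End_ring n)" and G: "G \<in> carrier (End_ring n)"
  shows "F \<ominus>\<^bsub>End_ring n\<^esub> G = (\<lambda>p. F p - G p)"
proof -
  interpret E: ring "End_ring n :: ('k mpoly \<Rightarrow> 'k mpoly) ring" by (rule ring_End_ring)
  have "\<ominus>\<^bsub>End_ring n\<^esub> G = (\<lambda>p. - G p)"
    by (rule E.minus_equality[OF _ G End_ring_uminus[OF G]]) (simp add: End_ring_def)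
  then show ?thesis
    by (simp add: a_minus_def) (simp add: End_ring_def)
qed

text \<open>The tautological action: polynomials act by multiplication, derivations by themselves.
  The relation between \<open>j D\<close> and \<open>i s\<close> is the Leibniz rule.\<close>

lemma LR_rep_End_ring:
  fixes L :: "('k::comm_ring_1 mpoly \<Rightarrow> 'k mpoly) set"
  assumes L: "LR_subalgebra n L"
  shows "LR_rep n L (End_ring n) (mult_op n) (\<lambda>D. D)"
proof -
  interpret E: ring "End_ring n :: ('k mpoly \<Rightarrow> 'k mpoly) ring" by (rule ring_End_ring)
  have der: "is_derivation n D" if "D \<in> L" for D
    using L that by (simp add: LR_subalgebra_def)
  have DE: "D \<in> carrier (End_ring n)" if "D \<in> L" for D
    using der[OF that] by (simp add: is_derivation_def End_ring_def)
  have ME: "mult_op n s \<in> carrier (End_ring n)" if "s \<in> polys n" for s :: "'k mpoly"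
    using that by (auto simp: mult_op_def End_ring_def algebra_simps)
  have mult: "F \<otimes>\<^bsub>End_ring n\<^esub> G = F \<circ> G" for F G :: "'k mpoly \<Rightarrow> 'k mpoly"
    by (simp add: End_ring_def)
  have comp: "F \<circ> G \<in> carrier (End_ring n)" if "F \<in> carrier (End_ring n)" "G \<in> carrier (End_ring n)"
    for F G :: "'k mpoly \<Rightarrow> 'k mpoly"
    using E.m_closed[OF that] by (simp add: mult)
  show ?thesis
    unfolding LR_rep_def mult
  proof (intro conjI ballI E.ring_axioms)
    show "mult_op n \<in> ring_hom (poly_ring n) (End_ring n)"
      using ME by (auto simp: ring_hom_def poly_ring_def mult_op_def End_ring_def fun_eq_iff algebra_simps)
    show "(\<lambda>D. D) \<in> L \<rightarrow> carrier (End_ring n)"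
      using DE by simp
  next
    fix D E assume "D \<in> L" "E \<in> L"
    then show "der_bracket D E = (D \<circ> E) \<ominus>\<^bsub>End_ring n\<^esub> (E \<circ> D)"
      by (simp add: End_ring_minus comp DE der_bracket_def)
    show "(\<lambda>p. D p + E p) = D \<oplus>\<^bsub>End_ring n\<^esub> E"
      by (simp add: End_ring_def)
  next
    fix s :: "'k mpoly" and D assume s: "s \<in> polys n" and D: "D \<in> L"
    show "mult_op n s \<circ> D = der_smult n s D"
      using der[OF D] by (auto simp: mult_op_def der_smult_def is_derivation_def fun_eq_iff)
    have "(D \<circ> mult_op n s) p - (mult_op n s \<circ> D) p = mult_op n (D s) p" for p
      using s der[OF D] derivation_0[OF der[OF D]]
      by (auto simp: mult_op_def is_derivation_def algebra_simps)
    then show "(D \<circ> mult_op n s) \<ominus>\<^bsub>End_ring n\<^esub> (mult_op n s \<circ> D) = mult_op n (D s)"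
      by (simp add: End_ring_minus comp DE[OF D] ME[OF s])
  qed
qed

text \<open>The universal property only quantifies over rings of type \<open>'u + 'k mpoly\<close>, whereas
  \<open>End_ring n\<close> may be strictly larger than that type. The subring generated by \<open>S\<close> and the
  basis of \<open>L\<close> has the cardinality of \<open>S\<close>, so a copy of it fits.\<close>

lemma UEA_inj:
  includes cardinal_syntax
  fixes L :: "('k::field_char_0 mpoly \<Rightarrow> 'k mpoly) set" and U :: "'u ring"
  assumes L: "LR_subalgebra n L" and \<alpha>: "\<And>l. l < n \<Longrightarrow> \<alpha> l \<in> L"
    and span: "\<And>D. D \<in> L \<Longrightarrow> \<exists>c. (\<forall>l<n. c l \<in> polys n) \<and> D = (\<lambda>p. \<Sum>l<n. der_smult n (c l) (\<alpha> l) p)"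
    and uea: "is_UEA n L U i j"
  shows "inj_on i (polys n)"
proof -
  let ?E = "End_ring n :: ('k mpoly \<Rightarrow> 'k mpoly) ring"
  interpret E: ring ?E by (rule ring_End_ring)
  note rep = LR_rep_End_ring[OF L]
  let ?H = "mult_op n ` polys n \<union> \<alpha> ` {..<n}"
  let ?K = "generate_ring ?E ?H"
  have H: "?H \<subseteq> carrier ?E"
    using LR_repD(3,4)[OF rep] \<alpha> by auto
  have K: "subring ?K ?E"
    by (rule E.generate_ring_is_subring[OF H])
  have LK: "D \<in> ?K" if "D \<in> L" for D
  proof -
    obtain c where c: "\<forall>l<n. c l \<in> polys n" and D: "D = (\<lambda>p. \<Sum>l<n. der_smult n (c l) (\<alpha> l) p)"
      using span[OF \<open>D \<in> L\<close>] by blast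
    \<comment> \<open>Only the finitely many \<open>\<alpha> l\<close> are generators, which keeps
      the cardinality under control. Partial sums of the basis expansion show that all of
      \<open>L\<close> still lies in \<open>?K\<close>.\<close>
    have "(\<lambda>p. \<Sum>l<k. der_smult n (c l) (\<alpha> l) p) \<in> ?K" if "k \<le> n" for k
      using that
    proof (induction k)
      case 0
      then show ?case
        using E.zero_in_generate[of ?H] by (simp add: End_ring_def)
    next
      case (Suc k)
      have "mult_op n (c k) \<in> ?K" "\<alpha> k \<in> ?K"
        using c Suc.prems by (auto intro: generate_ring.incl)
      then have "mult_op n (c k) \<otimes>\<^bsub>?E\<^esub> \<alpha> k \<in> ?K"
        by (rule generate_ring.eng_mult)
      then have "der_smult n (c k) (\<alpha> k) \<in> ?K"
        using c \<alpha> Suc.prems LR_repD(7)[OF rep] by simp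
      from generate_ring.eng_add[OF Suc.IH this] Suc.prems show ?case
        by (simp add: End_ring_def)
    qed
    from this[of n] show ?thesis by (simp add: D)
  qed
  have inf: "infinite (UNIV :: 'k mpoly set)"
    using infinite_UNIV_char_0 by blast
  have "|mult_op n ` (polys n :: 'k mpoly set)| \<le>o |UNIV :: 'k mpoly set|"
    by (rule ordLeq_transitive[OF card_of_image card_of_mono1]) simp
  moreover have "|\<alpha> ` {..<n}| \<le>o |UNIV :: 'k mpoly set|"
    using inf by (intro ordLess_imp_ordLeq finite_ordLess_infinite card_of_Well_order)
      (simp_all add: Field_card_of)
  ultimately have "|?K| \<le>o |UNIV :: 'k mpoly set|"
    by (intro card_of_generate_ring card_of_Un_le inf)
  \<comment> \<open>The cardinality bound yields only an injection of sets;
    \<open>image_ring\<close> transports the ring structure along it.\<close>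
  then obtain f :: "_ \<Rightarrow> 'k mpoly" where f: "inj_on f ?K"
    by (meson card_of_ordLeq)
  let ?g = "(Inr :: _ \<Rightarrow> 'u + 'k mpoly) \<circ> f"
  have g: "inj_on ?g (carrier (?E\<lparr>carrier := ?K\<rparr>))"
    using f by (simp add: inj_on_def)
  have "LR_rep n L (?E\<lparr>carrier := ?K\<rparr>) (mult_op n) (\<lambda>D. D)"
    by (rule LR_rep_subring[OF rep K]) (use LK in \<open>auto intro: generate_ring.incl\<close>)
  from is_UEAD(1)[OF uea LR_rep_image_ring[OF this g]]
  obtain \<phi> where \<phi>: "\<forall>s\<in>polys n. \<phi> (i s) = (?g \<circ> mult_op n) s"
    by blast
  show ?thesis
  proof (rule inj_onI)
    fix s t assume st: "s \<in> polys n" "t \<in> polys n" "i s = i t"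
    then have "f (mult_op n s) = f (mult_op n t)"
      using bspec[OF \<phi> st(1)] bspec[OF \<phi> st(2)] by simp
    then have "mult_op n s = mult_op n t"
      by (rule inj_onD[OF f]) (use st in \<open>auto intro: generate_ring.incl\<close>)
    \<comment> \<open>Evaluation at 1 recovers a polynomial from its multiplication operator, so S
      acts faithfully.\<close>
    then have "mult_op n s 1 = mult_op n t 1" by simp
    then show "s = t" by (simp add: mult_op_def)
  qed
qed

section \<open>Skew polynomial extensions\<close>

text \<open>In the intended instance \<open>W\<close> is \<open>W (Suc k)\<close>, \<open>I\<close>
  is the image of S, \<open>a\<close> is \<open>j (\<alpha> k)\<close>, \<open>x\<close> is the
  image of \<open>Var k\<close>, and \<open>f\<close> is the commutator of \<open>a\<close> and
  \<open>x\<close>. In \<open>a_W\<close> the coefficient \<open>c\<close> may differ from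
  \<open>w\<close>, since a bracket of \<open>\<alpha> k\<close> with a later basis element can have
  a component along \<open>\<alpha> k\<close>; on \<open>I\<close>, by \<open>a_I\<close>, moving
  \<open>a\<close> across keeps the coefficient.\<close>

locale skew_extension = ring R for R (structure) +
  fixes W I a x f
  assumes W: "subring W R" and I_W: "I \<subseteq> W" and a [simp]: "a \<in> carrier R"
    and a_W: "w \<in> W \<Longrightarrow> \<exists>b\<in>W. \<exists>c\<in>W. a \<otimes> w = b \<oplus> c \<otimes> a"
    and a_I: "s \<in> I \<Longrightarrow> \<exists>t\<in>I. a \<otimes> s = s \<otimes> a \<oplus> t"
    and x: "x \<in> I" and x_W: "w \<in> W \<Longrightarrow> w \<otimes> x = x \<otimes> w"
    and f: "f \<in> I" and a_x: "a \<otimes> x = x \<otimes> a \<oplus> f"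
begin

lemmas W_closed [simp, intro] = subringE(2,3,5,6,7)[OF W]

lemma W_carrier [simp]: "w \<in> W \<Longrightarrow> w \<in> carrier R"
  using subringE(1)[OF W] by blast

lemma I_in_W [simp]: "s \<in> I \<Longrightarrow> s \<in> W"
  using I_W by blast

text \<open>\<open>has_lead d u w\<close>: \<open>u = w\<^sub>0 + w\<^sub>1 a + \<dots> + w\<^sub>d a\<^sup>d\<close> with all \<open>w\<^sub>m \<in> W\<close> and \<open>w\<^sub>d = w\<close>. Uniqueness of such
  an expansion is not assumed.\<close>

inductive has_lead :: "nat \<Rightarrow> 'a \<Rightarrow> 'a \<Rightarrow> bool" where
  base: "w \<in> W \<Longrightarrow> has_lead 0 w w"
| step: "has_lead d v w \<Longrightarrow> b \<in> W \<Longrightarrow> has_lead (Suc d) (b \<oplus> v \<otimes> a) w"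

inductive_cases has_lead_0E: "has_lead 0 u w"
inductive_cases has_lead_SucE: "has_lead (Suc d) u w"

lemma has_lead_closed:
  assumes "has_lead d u w"
  shows has_lead_carrier: "u \<in> carrier R" and has_lead_W: "w \<in> W"
  using assms by (induction, simp_all)

lemma has_lead_add:
  assumes "has_lead d u w" "has_lead d u' w'"
  shows "has_lead d (u \<oplus> u') (w \<oplus> w')"
  using assms
proof (induction arbitrary: u' w')
  case (base w)
  then show ?case by (auto elim!: has_lead_0E intro: has_lead.base)
next
  case (step d v w b)
  from step.prems obtain b' v' where u': "u' = b' \<oplus> v' \<otimes> a" "b' \<in> W" "has_lead d v' w'"
    by (auto elim: has_lead_SucE)
  have "v \<in> carrier R" "v' \<in> carrier R"
    using step.hyps(1) u'(3) has_lead_carrier by auto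
  then have "b \<oplus> v \<otimes> a \<oplus> u' = (b \<oplus> b') \<oplus> (v \<oplus> v') \<otimes> a"
    using u' step.hyps by (simp add: l_distr a_ac)
  then show ?case
    using has_lead.step[OF step.IH[OF u'(3)], of "b \<oplus> b'"] step.hyps u' by simp
qed

text \<open>The index \<open>d\<close> only bounds the degree, because the leading coefficient may
  vanish. Padding with zeros brings expansions to a common length before they are added.\<close>

lemma has_lead_lift:
  assumes "has_lead d u w"
  shows "has_lead (Suc d) u \<zero>"
  using assms
proof induction
  case (base w)
  then show ?case
    using has_lead.step[OF has_lead.base, of \<zero> w] by simp
qed (rule has_lead.step)

lemma has_lead_lift': "has_lead d u w \<Longrightarrow> \<exists>w'. has_lead (d + m) u w'"
  by (induction m) (auto dest: has_lead_lift)

lemma has_lead_drop: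
  assumes "has_lead (Suc d) u \<zero>"
  shows "\<exists>w. has_lead d u w"
  using assms
proof (induction d arbitrary: u)
  case 0
  then show ?case
    by (auto elim!: has_lead_SucE has_lead_0E intro!: exI[of _ u] has_lead.base)
next
  case (Suc d)
  from Suc.prems obtain b v where u: "u = b \<oplus> v \<otimes> a" "b \<in> W" "has_lead (Suc d) v \<zero>"
    by (auto elim: has_lead_SucE)
  from Suc.IH[OF u(3)] u show ?case
    by (auto intro: has_lead.step)
qed

text \<open>By \<open>a_I\<close>, moving \<open>s\<close> to the left across \<open>a\<close> keeps
  \<open>s\<close> as coefficient and produces an error \<open>t\<close> in \<open>I\<close>. The
  error term \<open>v \<otimes> t\<close> has smaller degree bound, so the leading coefficient is
  just multiplied by \<open>s\<close>. The induction is over all \<open>s\<close> because it is also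
  applied to \<open>t\<close>.\<close>

lemma has_lead_right_mult:
  assumes "has_lead d u w" "s \<in> I"
  shows "has_lead d (u \<otimes> s) (w \<otimes> s)"
  using assms
proof (induction arbitrary: s)
  case (base w)
  then show ?case by (simp add: has_lead.base)
next
  case (step d v w b)
  obtain t where t: "t \<in> I" "a \<otimes> s = s \<otimes> a \<oplus> t"
    using a_I[OF step.prems] by blast
  have v: "v \<in> carrier R" and w: "w \<in> W"
    using step.hyps(1) by (rule has_lead_closed)+
  have "(b \<oplus> v \<otimes> a) \<otimes> s = b \<otimes> s \<oplus> v \<otimes> (s \<otimes> a \<oplus> t)"
    using v step.prems step.hyps(2) by (simp add: l_distr m_assoc flip: t(2))
  also have "\<dots> = (b \<otimes> s \<oplus> v \<otimes> s \<otimes> a) \<oplus> v \<otimes> t"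
    using v t step.prems step.hyps(2) by (simp add: r_distr m_assoc a_assoc)
  finally have eq: "(b \<oplus> v \<otimes> a) \<otimes> s = (b \<otimes> s \<oplus> v \<otimes> s \<otimes> a) \<oplus> v \<otimes> t" .
  have "has_lead (Suc d) (b \<otimes> s \<oplus> v \<otimes> s \<otimes> a) (w \<otimes> s)"
    using step by (intro has_lead.step) auto
  from has_lead_add[OF this has_lead_lift[OF step.IH[OF t(1)]]] show ?case
    unfolding eq using w step.prems by simp
qed

lemma has_lead_left_mult:
  assumes "has_lead d u w" "b \<in> W"
  shows "has_lead d (b \<otimes> u) (b \<otimes> w)"
  using assms
proof (induction)
  case (base w)
  then show ?case by (simp add: has_lead.base)
next
  case (step d v w b')
  have "b \<otimes> (b' \<oplus> v \<otimes> a) = b \<otimes> b' \<oplus> (b \<otimes> v) \<otimes> a"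
    using has_lead_carrier[OF step.hyps(1)] step.hyps(2) step.prems by (simp add: r_distr m_assoc)
  then show ?case
    using has_lead.step[OF step.IH, of "b \<otimes> b'"] step.hyps(2) step.prems by simp
qed

text \<open>The leading coefficient is left unspecified because \<open>a_W\<close> does not
  determine how \<open>c\<close> depends on \<open>w\<close>.\<close>

lemma has_lead_a_mult:
  assumes "has_lead d u w"
  shows "\<exists>w'. has_lead (Suc d) (a \<otimes> u) w'"
  using assms
proof (induction)
  case (base w)
  then obtain b c where "b \<in> W" "c \<in> W" "a \<otimes> w = b \<oplus> c \<otimes> a"
    using a_W by blast
  then show ?case
    using has_lead.step[OF has_lead.base] by metis
next
  case (step d v w b)
  obtain b' c where bc: "b' \<in> W" "c \<in> W" "a \<otimes> b = b' \<oplus> c \<otimes> a"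
    using a_W step.hyps by blast
  obtain w' where "has_lead (Suc d) (a \<otimes> v) w'"
    using step.IH by blast
  moreover obtain w'' where "has_lead (Suc d) c w''"
    using has_lead_lift'[OF has_lead.base[OF bc(2)], of "Suc d"] by auto
  ultimately have "has_lead (Suc (Suc d)) (b' \<oplus> (c \<oplus> a \<otimes> v) \<otimes> a) (w'' \<oplus> w')"
    using bc by (intro has_lead.step has_lead_add)
  moreover have "a \<otimes> (b \<oplus> v \<otimes> a) = b' \<oplus> (c \<oplus> a \<otimes> v) \<otimes> a"
    using bc has_lead_carrier[OF step.hyps(1)] step.hyps(2)
    by (simp add: r_distr l_distr m_assoc a_assoc)
  ultimately show ?case by auto
qed

lemma has_lead_exists:
  assumes "u \<in> generate_ring R (insert a W)"
  shows "\<exists>d w. has_lead d u w"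
proof -
  define V where "V = {u. \<exists>d w. has_lead d u w}"
  have V_carrier: "u \<in> carrier R" if "u \<in> V" for u
    using that has_lead_carrier by (auto simp: V_def)
  have V_add: "u \<oplus> v \<in> V" if uv: "u \<in> V" "v \<in> V" for u v
  proof -
    obtain d w d' w' where "has_lead d u w" "has_lead d' v w'"
      using uv by (auto simp: V_def)
    then obtain w1 w2 where "has_lead (d + d') u w1" "has_lead (d' + d) v w2"
      using has_lead_lift' by metis
    then show ?thesis
      using has_lead_add[of "d + d'" u w1 v w2] unfolding V_def by (auto simp: add.commute)
  qed
  have V_left: "b \<otimes> u \<in> V" if "b \<in> W" "u \<in> V" for b u
    using that has_lead_left_mult unfolding V_def by blast
  \<comment> \<open>Instead of closing \<open>V\<close> under products directly, the induction shows
    that left multiplication by \<open>u\<close> preserves \<open>V\<close>, which needs only the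
    cases of \<open>W\<close> and \<open>a\<close>. Applying this to the unit gives the
    claim.\<close>
  have "u \<in> carrier R \<and> (\<forall>v\<in>V. u \<otimes> v \<in> V)"
    using assms
  proof induction
    case one
    then show ?case by (simp add: V_carrier)
  next
    case (incl h)
    have "a \<otimes> v \<in> V" if "v \<in> V" for v
      using that has_lead_a_mult unfolding V_def by blast
    with incl show ?case using V_left by auto
  next
    case (a_inv h)
    \<comment> \<open>Negation is left multiplication by the negative of the unit, an element of
      \<open>W\<close>.\<close>
    have "(\<ominus> h) \<otimes> v = (\<ominus> \<one>) \<otimes> (h \<otimes> v)" if "v \<in> V" for v
      using that a_inv.IH V_carrier by (simp add: l_minus)
    then show ?case
      using a_inv.IH V_left by simp
  next
    case (eng_add h1 h2)
    then show ?case using V_carrier V_add by (simp add: l_distr)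
  next
    case (eng_mult h1 h2)
    then show ?case using V_carrier by (simp add: m_assoc)
  qed
  moreover have "\<one> \<in> V"
    using has_lead.base[of \<one>] by (auto simp: V_def)
  ultimately have "u \<otimes> \<one> \<in> V" "u \<in> carrier R" by blast+
  then show ?thesis by (simp add: V_def)
qed

text \<open>Commuting with \<open>x\<close> acts like differentiation with respect to \<open>a\<close>, scaled by \<open>f = [a, x]\<close>.\<close>

lemma has_lead_commutator:
  assumes "has_lead (Suc d) u w"
  shows "\<exists>c. has_lead d c ([Suc d] \<cdot> (w \<otimes> f)) \<and> u \<otimes> x = x \<otimes> u \<oplus> c"
  using assms
proof (induction d arbitrary: u)
  case 0
  then obtain b where u: "u = b \<oplus> w \<otimes> a" "b \<in> W" "w \<in> W"
    by (auto elim!: has_lead_SucE has_lead_0E)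
  have "u \<otimes> x = b \<otimes> x \<oplus> w \<otimes> (x \<otimes> a \<oplus> f)"
    using u x f by (simp add: l_distr m_assoc flip: a_x)
  also have "\<dots> = x \<otimes> b \<oplus> (x \<otimes> w \<otimes> a \<oplus> w \<otimes> f)"
    using u x f by (simp add: r_distr x_W flip: m_assoc)
  also have "\<dots> = x \<otimes> u \<oplus> w \<otimes> f"
    using u x f by (simp add: r_distr m_assoc a_assoc)
  finally show ?case
    using u f by (auto intro!: exI[of _ "w \<otimes> f"] has_lead.base)
next
  case (Suc d)
  obtain b v where u: "u = b \<oplus> v \<otimes> a" "b \<in> W" and v: "has_lead (Suc d) v w"
    using Suc.prems by (auto elim: has_lead_SucE)
  obtain c where c: "has_lead d c ([Suc d] \<cdot> (w \<otimes> f))" "v \<otimes> x = x \<otimes> v \<oplus> c"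
    using Suc.IH[OF v] by blast
  note carr = has_lead_carrier[OF v] has_lead_carrier[OF c(1)] has_lead_W[OF v]
  have "u \<otimes> x = b \<otimes> x \<oplus> v \<otimes> (x \<otimes> a \<oplus> f)"
    using u x f carr by (simp add: l_distr m_assoc flip: a_x)
  also have "\<dots> = x \<otimes> b \<oplus> ((x \<otimes> v \<oplus> c) \<otimes> a \<oplus> v \<otimes> f)"
    using u x f carr by (simp add: r_distr x_W flip: m_assoc c(2))
  also have "\<dots> = x \<otimes> u \<oplus> ((\<zero> \<oplus> c \<otimes> a) \<oplus> v \<otimes> f)"
    using u x f carr by (simp add: r_distr l_distr m_assoc a_assoc)
  finally have "u \<otimes> x = x \<otimes> u \<oplus> ((\<zero> \<oplus> c \<otimes> a) \<oplus> v \<otimes> f)" .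
  \<comment> \<open>The commutator of \<open>v \<otimes> a\<close> with \<open>x\<close> is
    \<open>c \<otimes> a\<close> plus \<open>v \<otimes> f\<close>: the first contributes
    \<open>Suc d\<close> copies of \<open>w \<otimes> f\<close> to the leading coefficient, the
    second one more. The summand \<open>\<zero>\<close> puts \<open>c \<otimes> a\<close> into the
    form that \<open>has_lead.step\<close> produces.\<close>
  moreover have "has_lead (Suc d) ((\<zero> \<oplus> c \<otimes> a) \<oplus> v \<otimes> f) ([Suc d] \<cdot> (w \<otimes> f) \<oplus> w \<otimes> f)"
    by (intro has_lead_add has_lead.step has_lead_right_mult c v f W_closed)
  ultimately show ?case
    using carr f by (auto simp: add.nat_pow_Suc)
qed

context
  assumes f_regular: "\<And>k w. w \<in> W \<Longrightarrow> [Suc k] \<cdot> (w \<otimes> f) = \<zero> \<Longrightarrow> w = \<zero>"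
begin

text \<open>This is uniqueness of expansions. The commutator of zero with \<open>x\<close> is zero,
  yet it has an expansion one degree lower with leading coefficient a positive multiple of
  \<open>w \<otimes> f\<close>; by induction that multiple vanishes, and \<open>f_regular\<close>
  cancels it.\<close>

lemma has_lead_zero: "has_lead d \<zero> w \<Longrightarrow> w = \<zero>"
proof (induction d arbitrary: w)
  case 0
  then show ?case by (auto elim: has_lead_0E)
next
  case (Suc d)
  obtain c where c: "has_lead d c ([Suc d] \<cdot> (w \<otimes> f))" "\<zero> \<otimes> x = x \<otimes> \<zero> \<oplus> c"
    using has_lead_commutator[OF Suc.prems] by blast
  then have "c = \<zero>"
    using x has_lead_carrier[OF c(1)] by simp
  then show ?case
    using Suc.IH c(1) f_regular has_lead_W[OF Suc.prems] by blast
qed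

text \<open>The zero element \<open>u \<otimes> g\<close> has leading coefficient
  \<open>w \<otimes> g\<close>, so \<open>w = \<zero>\<close> and the degree bound of
  \<open>u\<close> drops. At degree zero \<open>u\<close> lies in \<open>W\<close>, where
  \<open>g\<close> is regular by assumption.\<close>

lemma regular_extend:
  assumes u: "u \<in> generate_ring R (insert a W)" and g: "g \<in> I" and "u \<otimes> g = \<zero>"
    and g_regular: "\<And>w. w \<in> W \<Longrightarrow> w \<otimes> g = \<zero> \<Longrightarrow> w = \<zero>"
  shows "u = \<zero>"
proof -
  obtain d w where "has_lead d u w"
    using has_lead_exists[OF u] by blast
  then show ?thesis
  proof (induction d arbitrary: w)
    case 0
    then show ?case
      using \<open>u \<otimes> g = \<zero>\<close> g_regular by (auto elim!: has_lead_0E)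
  next
    case (Suc d)
    have "w = \<zero>"
      using has_lead_right_mult[OF Suc.prems g] \<open>u \<otimes> g = \<zero>\<close> has_lead_zero g_regular
        has_lead_W[OF Suc.prems] by metis
    then show ?case
      using Suc.IH Suc.prems has_lead_drop by blast
  qed
qed

text \<open>The commutator with \<open>x\<close> vanishes, so its leading coefficient, a positive
  multiple of \<open>w \<otimes> f\<close>, does too. Hence \<open>w = \<zero>\<close>, and the
  degree bound can be lowered until \<open>u\<close> lies in \<open>W\<close>.\<close>

lemma commuting_in_W:
  assumes u: "u \<in> generate_ring R (insert a W)" and ux: "u \<otimes> x = x \<otimes> u"
  shows "u \<in> W"
proof -
  obtain d w where "has_lead d u w"
    using has_lead_exists[OF u] by blast
  then show ?thesis
  proof (induction d arbitrary: w)
    case 0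
    then show ?case by (auto elim: has_lead_0E)
  next
    case (Suc d)
    obtain c where c: "has_lead d c ([Suc d] \<cdot> (w \<otimes> f))" "u \<otimes> x = x \<otimes> u \<oplus> c"
      using has_lead_commutator[OF Suc.prems] by blast
    then have "c = \<zero>"
      using x has_lead_carrier[OF c(1)] has_lead_carrier[OF Suc.prems] ux
      by (metis I_in_W W_carrier add.l_cancel_one' m_closed)
    then have "w = \<zero>"
      using c(1) has_lead_zero f_regular has_lead_W[OF Suc.prems] by blast
    then show ?case
      using Suc.IH Suc.prems has_lead_drop by blast
  qed
qed

end

end

section \<open>Triangular bases and the center\<close>

text \<open>What the universal property contributes is recorded as \<open>i_inj\<close> and
  \<open>gen\<close>.\<close>

locale triangular_rep =
  fixes n :: nat and L :: "('k::field_char_0 mpoly \<Rightarrow> 'k mpoly) set"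
    and U :: "'u ring" (structure)
    and i :: "'k mpoly \<Rightarrow> 'u" and j :: "('k mpoly \<Rightarrow> 'k mpoly) \<Rightarrow> 'u"
    and \<alpha> :: "nat \<Rightarrow> 'k mpoly \<Rightarrow> 'k mpoly"
  assumes rep: "LR_rep n L U i j" and i_inj: "inj_on i (polys n)"
    and L: "LR_subalgebra n L" and \<alpha>_L: "l < n \<Longrightarrow> \<alpha> l \<in> L"
    and span: "D \<in> L \<Longrightarrow> \<exists>c. (\<forall>l<n. c l \<in> polys n) \<and> D = (\<lambda>p. \<Sum>l<n. der_smult n (c l) (\<alpha> l) p)"
    and triangular: "l < m \<Longrightarrow> m < n \<Longrightarrow> \<alpha> m (Var l) = 0"
    and diagonal: "l < n \<Longrightarrow> \<alpha> l (Var l) \<noteq> 0"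
    and gen: "carrier U = generate_ring U (i ` polys n \<union> j ` L)"
begin

sublocale ring U
  by (rule LR_repD(1)[OF rep])

lemmas i_closed [simp] = LR_repD(3)[OF rep]
lemmas j_closed [simp] = LR_repD(4)[OF rep]

lemma derivation: "D \<in> L \<Longrightarrow> is_derivation n D"
  using L by (simp add: LR_subalgebra_def)

lemma derivation_polys [simp]: "D \<in> L \<Longrightarrow> p \<in> polys n \<Longrightarrow> D p \<in> polys n"
  using derivation[of D] by (simp add: is_derivation_def)

lemma i_add: "p \<in> polys n \<Longrightarrow> q \<in> polys n \<Longrightarrow> i (p + q) = i p \<oplus> i q"
  and i_mult: "p \<in> polys n \<Longrightarrow> q \<in> polys n \<Longrightarrow> i (p * q) = i p \<otimes> i q"
  and i_1: "i 1 = \<one>"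
  using LR_repD(2)[OF rep] by (auto simp: ring_hom_def poly_ring_def)

lemma i_0: "i 0 = \<zero>"
  using i_add[of 0 0] by (metis add.l_cancel_one' add_0 i_closed polys_0)

lemma i_eq_0_iff: "p \<in> polys n \<Longrightarrow> i p = \<zero> \<longleftrightarrow> p = 0"
  using inj_onD[OF i_inj, of p 0] by (auto simp: i_0)

lemma i_uminus: "p \<in> polys n \<Longrightarrow> i (- p) = \<ominus> i p"
  by (rule minus_equality[symmetric]) (auto simp: i_0 polys_uminus simp flip: i_add)

lemma i_of_nat_mult: "p \<in> polys n \<Longrightarrow> i (of_nat k * p) = [k] \<cdot> i p"
proof (induction k)
  case (Suc k)
  have "i (of_nat (Suc k) * p) = i (of_nat k * p + p)"
    by (simp add: algebra_simps)
  also have "\<dots> = i (of_nat k * p) \<oplus> i p"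
    using Suc.prems by (intro i_add) auto
  finally show ?case
    using Suc by (simp add: add.nat_pow_Suc)
qed (simp add: i_0)

lemma minus_eqD: "\<lbrakk>u \<ominus> v = w; u \<in> carrier U; v \<in> carrier U\<rbrakk> \<Longrightarrow> u = v \<oplus> w"
  by (metis a_minus_def a_inv_closed add.inv_solve_right' a_comm minus_closed)

lemma j_i_commute:
  assumes "D \<in> L" "s \<in> polys n"
  shows "j D \<otimes> i s = i s \<otimes> j D \<oplus> i (D s)"
  using assms LR_repD(8)[OF rep] by (intro minus_eqD) auto

lemma j_commute:
  assumes "D \<in> L" "E \<in> L"
  shows "j D \<otimes> j E = j E \<otimes> j D \<oplus> j (der_bracket D E)"
  using assms LR_repD(6)[OF rep] by (intro minus_eqD) auto

lemma combination_in_subring: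
  assumes H: "subring H U" and c: "\<And>l. l < n \<Longrightarrow> c l \<in> polys n"
    and cH: "\<And>l. l < n \<Longrightarrow> i (c l) \<otimes> j (\<alpha> l) \<in> H" and "k \<le> n"
  shows "(\<lambda>p. \<Sum>l<k. der_smult n (c l) (\<alpha> l) p) \<in> L \<and> j (\<lambda>p. \<Sum>l<k. der_smult n (c l) (\<alpha> l) p) \<in> H"
  \<comment> \<open>Membership of the partial sums in \<open>L\<close> is proved alongside, since
    \<open>j\<close> is known to be additive only on \<open>L\<close>.\<close>
  using \<open>k \<le> n\<close>
proof (induction k)
  case 0
  have L0: "(\<lambda>_. 0) \<in> L"
    using L by (simp add: LR_subalgebra_def)
  have "j (\<lambda>_. 0) = j (\<lambda>_. 0) \<oplus> j (\<lambda>_. 0)"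
    using LR_repD(5)[OF rep L0 L0] by simp
  then have "j (\<lambda>_. 0) = \<zero>"
    by (metis L0 add.l_cancel_one' j_closed)
  then show ?case
    using L0 subringE(2)[OF H] by simp
next
  case (Suc k)
  have L': "der_smult n (c k) (\<alpha> k) \<in> L"
    using L c \<alpha>_L Suc.prems by (simp add: LR_subalgebra_def)
  have "j (der_smult n (c k) (\<alpha> k)) \<in> H"
    using cH[of k] LR_repD(7)[OF rep] c \<alpha>_L Suc.prems by simp
  then show ?case
    using Suc L' LR_repD(5)[OF rep _ L'] L subringE(7)[OF H]
    by (simp add: LR_subalgebra_def)
qed

section \<open>The chain of subrings \<open>W k\<close>\<close>

definition W :: "nat \<Rightarrow> 'u set" where
  "W k = generate_ring U (i ` polys n \<union> (\<lambda>l. j (\<alpha> l)) ` {k..<n})"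

lemma gens_carrier: "i ` polys n \<union> (\<lambda>l. j (\<alpha> l)) ` {k..<n} \<subseteq> carrier U"
  using \<alpha>_L by auto

lemma subring_W: "subring (W k) U"
  unfolding W_def by (rule generate_ring_is_subring[OF gens_carrier])

lemma i_in_W [simp]: "s \<in> polys n \<Longrightarrow> i s \<in> W k"
  by (auto simp: W_def intro: generate_ring.incl)

lemma j_in_W: "k \<le> l \<Longrightarrow> l < n \<Longrightarrow> j (\<alpha> l) \<in> W k"
  by (auto simp: W_def intro: generate_ring.incl)

lemma W_carrier: "w \<in> W k \<Longrightarrow> w \<in> carrier U"
  using subringE(1)[OF subring_W] by blast

lemma W_induct [consumes 1, case_names poly der uminus add mult]:
  assumes "w \<in> W k"
    and "\<And>s. s \<in> polys n \<Longrightarrow> P (i s)" and "\<And>l. k \<le> l \<Longrightarrow> l < n \<Longrightarrow> P (j (\<alpha> l))"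
    and "\<And>u. \<lbrakk>u \<in> W k; P u\<rbrakk> \<Longrightarrow> P (\<ominus> u)"
    and "\<And>u v. \<lbrakk>u \<in> W k; P u; v \<in> W k; P v\<rbrakk> \<Longrightarrow> P (u \<oplus> v)"
    and "\<And>u v. \<lbrakk>u \<in> W k; P u; v \<in> W k; P v\<rbrakk> \<Longrightarrow> P (u \<otimes> v)"
  shows "P w"
  using assms(1) unfolding W_def
proof induction
  case one
  then show ?case using assms(2)[of 1] by (simp add: i_1)
qed (use assms in \<open>auto simp: W_def\<close>)

lemma W_subset_generate:
  "k < n \<Longrightarrow> W k \<subseteq> generate_ring U (insert (j (\<alpha> k)) (W (Suc k)))"
proof -
  assume "k < n"
  then have sub: "insert (j (\<alpha> k)) (W (Suc k)) \<subseteq> carrier U"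
    using \<alpha>_L W_carrier by auto
  have "i ` polys n \<union> (\<lambda>l. j (\<alpha> l)) ` {k..<n} \<subseteq> insert (j (\<alpha> k)) (W (Suc k))"
  proof -
    have "j (\<alpha> l) \<in> insert (j (\<alpha> k)) (W (Suc k))" if "l \<in> {k..<n}" for l
      using that j_in_W[of "Suc k" l] by (cases "l = k") auto
    then show ?thesis using i_in_W by blast
  qed
  then show ?thesis
    unfolding W_def[of k]
    by (intro mono_generate_ring sub)
qed

lemma W_n: "W n = i ` polys n"
proof
  show "W n \<subseteq> i ` polys n"
  proof
    fix w assume "w \<in> W n"
    then show "w \<in> i ` polys n"
    proof (induction rule: W_induct)
      case (uminus u)
      then show ?case by (auto simp flip: i_uminus)
    next
      case (add u v)
      then show ?case by (auto simp flip: i_add)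
    next
      case (mult u v)
      then show ?case by (auto simp flip: i_mult)
    qed auto
  qed
qed auto

lemma W_0: "W 0 = carrier U"
proof
  show "carrier U \<subseteq> W 0"
    unfolding gen
  proof (rule generate_ring_min_subring1[OF _ subring_W])
    show "i ` polys n \<union> j ` L \<subseteq> carrier U" by auto
    have "j D \<in> W 0" if "D \<in> L" for D
    proof -
      obtain c where c: "\<forall>l<n. c l \<in> polys n" "D = (\<lambda>p. \<Sum>l<n. der_smult n (c l) (\<alpha> l) p)"
        using span[OF \<open>D \<in> L\<close>] by blast
      have "i (c l) \<otimes> j (\<alpha> l) \<in> W 0" if "l < n" for l
        using that c(1) by (intro subringE(6)[OF subring_W] j_in_W) auto
      then show ?thesis
        using combination_in_subring[OF subring_W[of 0], where c = c and k = n] c by simp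
    qed
    then show "i ` polys n \<union> j ` L \<subseteq> W 0" by auto
  qed
qed (use W_carrier in auto)

text \<open>Evaluating \<open>D\<close>, written in the basis, at \<open>x_0, x_1, ...\<close> gives
  a triangular system with nonzero diagonal, so the coefficients before index \<open>k\<close>
  vanish along with the values of \<open>D\<close>. The terms after index \<open>k\<close> go into
  \<open>W (Suc k)\<close>, leaving a multiple of \<open>\<alpha> k\<close>.\<close>

lemma derivation_decompose:
  assumes D: "D \<in> L" and D0: "\<And>l. l < k \<Longrightarrow> D (Var l) = 0" and "k < n"
  shows "\<exists>b\<in>W (Suc k). \<exists>s\<in>polys n. j D = b \<oplus> i s \<otimes> j (\<alpha> k)"
proof -
  obtain c where c: "\<forall>l<n. c l \<in> polys n" and Dc: "D = (\<lambda>p. \<Sum>l<n. der_smult n (c l) (\<alpha> l) p)"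
    using span[OF D] by blast
  have c0: "c l = 0" if "l < k" for l
    using that
  proof (induction l rule: less_induct)
    case (less l)
    \<comment> \<open>For \<open>m < l\<close> the coefficient vanishes by induction, for
      \<open>m > l\<close> the value does by triangularity; only the diagonal term survives.\<close>
    have "c m * \<alpha> m (Var l) = 0" if "m < n" "m \<noteq> l" for m
      using that less triangular[of l m] by (cases "m < l") auto
    then have "(\<Sum>m<n. c m * \<alpha> m (Var l)) = (\<Sum>m<n. if m = l then c l * \<alpha> l (Var l) else 0)"
      by (intro sum.cong) auto
    then have "c l * \<alpha> l (Var l) = D (Var l)"
      using less.prems \<open>k < n\<close> by (simp add: Dc der_smult_def polys_Var)
    then show ?case
      using D0 less.prems diagonal[of l] \<open>k < n\<close> by auto
  qed
  \<comment> \<open>Dropping the coefficient at \<open>k\<close> leaves only indices above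
    \<open>k\<close>.\<close>
  define c' where "c' = c(k := 0)"
  let ?D' = "\<lambda>p. \<Sum>l<n. der_smult n (c' l) (\<alpha> l) p"
  have c'_polys: "c' l \<in> polys n" if "l < n" for l
    using that c by (simp add: c'_def)
  have c'_W: "i (c' l) \<otimes> j (\<alpha> l) \<in> W (Suc k)" if "l < n" for l
  proof (cases "l \<le> k")
    case True
    then have "c' l = 0" using c0 by (simp add: c'_def)
    then show ?thesis
      using that \<alpha>_L subringE(2)[OF subring_W] by (simp add: i_0)
  next
    case False
    then show ?thesis
      using that c'_polys by (intro subringE(6)[OF subring_W] j_in_W) auto
  qed
  have D': "?D' \<in> L" "j ?D' \<in> W (Suc k)"
    using combination_in_subring[OF subring_W c'_polys c'_W, of n] by auto
  have "D p = ?D' p + der_smult n (c k) (\<alpha> k) p" for p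
  proof -
    have "D p = (\<Sum>l<n. der_smult n (c' l) (\<alpha> l) p + (if l = k then der_smult n (c k) (\<alpha> k) p else 0))"
      unfolding Dc by (intro sum.cong) (auto simp: c'_def der_smult_def)
    then show ?thesis
      using \<open>k < n\<close> by (simp add: sum.distrib)
  qed
  then have "D = (\<lambda>p. ?D' p + der_smult n (c k) (\<alpha> k) p)" by blast
  moreover have "der_smult n (c k) (\<alpha> k) \<in> L"
    using L c \<alpha>_L \<open>k < n\<close> by (simp add: LR_subalgebra_def)
  ultimately have "j D = j ?D' \<oplus> i (c k) \<otimes> j (\<alpha> k)"
    using LR_repD(5)[OF rep D'(1)] LR_repD(7)[OF rep, of "c k" "\<alpha> k"] c \<alpha>_L \<open>k < n\<close> by simp
  then show ?thesis
    using D'(2) c \<open>k < n\<close> by auto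
qed

text \<open>For \<open>m < k < l\<close> both derivations kill \<open>x_m\<close>, hence so does
  their bracket.\<close>

lemma bracket_decompose:
  assumes "k < l" "l < n"
  shows "\<exists>b\<in>W (Suc k). \<exists>s\<in>polys n. j (der_bracket (\<alpha> k) (\<alpha> l)) = b \<oplus> i s \<otimes> j (\<alpha> k)"
proof (rule derivation_decompose)
  show "der_bracket (\<alpha> k) (\<alpha> l) \<in> L"
    using L \<alpha>_L assms by (simp add: LR_subalgebra_def)
  show "der_bracket (\<alpha> k) (\<alpha> l) (Var m) = 0" if "m < k" for m
    using that assms \<alpha>_L by (simp add: der_bracket_def triangular derivation_0[OF derivation])
qed (use assms in simp)

text \<open>The rule for moving \<open>j (\<alpha> k)\<close> past \<open>W (Suc k)\<close> is
  checked on generators and extended through sums and products. For a polynomial it is the Leibniz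
  rule; for a later \<open>\<alpha> l\<close> it comes from \<open>bracket_decompose\<close>, with
  coefficient \<open>j (\<alpha> l) \<oplus> i s\<close>. The image of \<open>Var k\<close> commutes
  with \<open>W (Suc k)\<close> because every later \<open>\<alpha> l\<close> kills
  \<open>x_k\<close>.\<close>

lemma skew_extension_W:
  assumes k: "k < n"
  shows "skew_extension U (W (Suc k)) (i ` polys n) (j (\<alpha> k)) (i (Var k)) (i (\<alpha> k (Var k)))"
proof -
  let ?W = "W (Suc k)" and ?a = "j (\<alpha> k)" and ?x = "i (Var k)"
  note W = subringE(2,3,5,6,7)[OF subring_W[of "Suc k"]]
  have a: "?a \<in> carrier U"
    using \<alpha>_L k by simp
  have x: "(Var k :: 'k mpoly) \<in> polys n"
    using k by (rule polys_Var)
  have comm: "\<exists>b\<in>?W. \<exists>c\<in>?W. ?a \<otimes> w = b \<oplus> c \<otimes> ?a" if "w \<in> ?W" for w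
    using that
  proof (induction rule: W_induct)
    case (poly s)
    then have "?a \<otimes> i s = i (\<alpha> k s) \<oplus> i s \<otimes> ?a"
      using \<alpha>_L[OF k] a by (simp add: j_i_commute a_comm)
    then show ?case
      using poly \<alpha>_L[OF k] by (metis derivation_polys i_in_W)
  next
    case (der l)
    then have l: "k < l" "l < n" by auto
    obtain b s where bs: "b \<in> ?W" "s \<in> polys n" "j (der_bracket (\<alpha> k) (\<alpha> l)) = b \<oplus> i s \<otimes> ?a"
      using bracket_decompose[OF l] by blast
    have "?a \<otimes> j (\<alpha> l) = j (\<alpha> l) \<otimes> ?a \<oplus> (b \<oplus> i s \<otimes> ?a)"
      using j_commute[of "\<alpha> k" "\<alpha> l"] \<alpha>_L k l by (simp add: bs(3))
    also have "\<dots> = b \<oplus> (j (\<alpha> l) \<oplus> i s) \<otimes> ?a"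
      using \<alpha>_L l a bs W_carrier by (simp add: l_distr a_ac)
    finally have "?a \<otimes> j (\<alpha> l) = b \<oplus> (j (\<alpha> l) \<oplus> i s) \<otimes> ?a" .
    moreover have "j (\<alpha> l) \<oplus> i s \<in> ?W"
      using der bs(2) by (intro W j_in_W i_in_W)
    ultimately show ?case
      using bs(1) by metis
  next
    case (uminus u)
    then obtain b c where bc: "b \<in> ?W" "c \<in> ?W" "?a \<otimes> u = b \<oplus> c \<otimes> ?a" by metis
    have "?a \<otimes> (\<ominus> u) = (\<ominus> b) \<oplus> (\<ominus> c) \<otimes> ?a"
      using a bc uminus.hyps W_carrier by (simp add: r_minus l_minus minus_add)
    moreover have "\<ominus> b \<in> ?W" "\<ominus> c \<in> ?W"
      by (intro W bc)+
    ultimately show ?case by metis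
  next
    case (add u v)
    obtain b c where bc: "b \<in> ?W" "c \<in> ?W" "?a \<otimes> u = b \<oplus> c \<otimes> ?a"
      using add.IH(1) by metis
    obtain b' c' where bc': "b' \<in> ?W" "c' \<in> ?W" "?a \<otimes> v = b' \<oplus> c' \<otimes> ?a"
      using add.IH(2) by metis
    have "?a \<otimes> (u \<oplus> v) = (b \<oplus> b') \<oplus> (c \<oplus> c') \<otimes> ?a"
      using a bc bc' add.hyps W_carrier by (simp add: r_distr l_distr a_ac)
    moreover have "b \<oplus> b' \<in> ?W" "c \<oplus> c' \<in> ?W"
      by (intro W bc bc')+
    ultimately show ?case by metis
  next
    case (mult u v)
    obtain b c where bc: "b \<in> ?W" "c \<in> ?W" "?a \<otimes> u = b \<oplus> c \<otimes> ?a"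
      using mult.IH(1) by metis
    obtain b' c' where bc': "b' \<in> ?W" "c' \<in> ?W" "?a \<otimes> v = b' \<oplus> c' \<otimes> ?a"
      using mult.IH(2) by metis
    have carr: "u \<in> carrier U" "v \<in> carrier U" "b \<in> carrier U" "c \<in> carrier U"
      "b' \<in> carrier U" "c' \<in> carrier U"
      using mult.hyps bc bc' W_carrier by auto
    have "?a \<otimes> (u \<otimes> v) = (b \<oplus> c \<otimes> ?a) \<otimes> v"
      using a carr by (simp flip: m_assoc bc(3))
    also have "\<dots> = b \<otimes> v \<oplus> c \<otimes> (b' \<oplus> c' \<otimes> ?a)"
      using a carr by (simp add: l_distr m_assoc flip: bc'(3))
    also have "\<dots> = (b \<otimes> v \<oplus> c \<otimes> b') \<oplus> (c \<otimes> c') \<otimes> ?a"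
      using a carr by (simp add: r_distr m_assoc a_assoc)
    finally have "?a \<otimes> (u \<otimes> v) = (b \<otimes> v \<oplus> c \<otimes> b') \<oplus> (c \<otimes> c') \<otimes> ?a" .
    moreover have "b \<otimes> v \<oplus> c \<otimes> b' \<in> ?W" "c \<otimes> c' \<in> ?W"
      by (intro W bc bc' mult.hyps)+
    ultimately show ?case by metis
  qed
  have x_comm: "w \<otimes> ?x = ?x \<otimes> w" if "w \<in> ?W" for w
    using that
  proof (induction rule: W_induct)
    case (poly s)
    then show ?case using i_mult[OF _ x] i_mult[OF x] by (simp add: mult.commute)
  next
    case (der l)
    then show ?case using x \<alpha>_L by (simp add: j_i_commute triangular i_0)
  next
    case (uminus u)
    then show ?case using x W_carrier by (simp add: l_minus r_minus)
  next
    case (add u v)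
    then show ?case using x W_carrier by (simp add: l_distr r_distr)
  next
    case (mult u v)
    have carr: "u \<in> carrier U" "v \<in> carrier U" "?x \<in> carrier U"
      using mult.hyps W_carrier x by auto
    then have "u \<otimes> v \<otimes> ?x = u \<otimes> ?x \<otimes> v"
      by (simp add: m_assoc mult.IH(2))
    then show ?case
      using carr by (simp add: m_assoc mult.IH(1))
  qed
  show ?thesis
  proof (intro skew_extension.intro skew_extension_axioms.intro ring_axioms subring_W a comm x_comm)
    show "\<exists>t\<in>i ` polys n. ?a \<otimes> s = s \<otimes> ?a \<oplus> t" if "s \<in> i ` polys n" for s
      using that \<alpha>_L[OF k] by (auto simp: j_i_commute)
  qed (use x \<alpha>_L[OF k] in \<open>auto simp: j_i_commute\<close>)
qed

text \<open>The integer is absorbed into the polynomial: \<open>of_nat (Suc k) * g\<close> is again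
  nonzero in characteristic zero. This supplies \<open>f_regular\<close>.\<close>

lemma scaled_regular:
  assumes reg: "\<And>g w. \<lbrakk>g \<in> polys n; g \<noteq> 0; w \<in> W m; w \<otimes> i g = \<zero>\<rbrakk> \<Longrightarrow> w = \<zero>"
    and g: "g \<in> polys n" "g \<noteq> 0" and w: "w \<in> W m" "[Suc k] \<cdot> (w \<otimes> i g) = \<zero>"
  shows "w = \<zero>"
proof (rule reg)
  show "of_nat (Suc k) * g \<in> polys n"
    using g by blast
  show "of_nat (Suc k) * g \<noteq> 0"
    using g by (simp del: of_nat_Suc)
  show "w \<otimes> i (of_nat (Suc k) * g) = \<zero>"
    using w g W_carrier by (simp only: i_of_nat_mult add_pow_rdistr[OF W_carrier i_closed])
qed (rule w)

text \<open>Downward induction from \<open>W n\<close>, the injective image of the domain S. The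
  hypothesis on \<open>W (Suc k)\<close> is used twice, for \<open>g\<close> itself and for
  multiples of \<open>\<alpha> k (Var k)\<close>, which is why \<open>g\<close> is
  generalised.\<close>

lemma W_regular:
  assumes "k \<le> n" "g \<in> polys n" "g \<noteq> 0" "w \<in> W k" "w \<otimes> i g = \<zero>"
  shows "w = \<zero>"
  using assms
proof (induction k arbitrary: g w rule: inc_induct)
  case base
  then show ?case
    by (auto simp: W_n i_eq_0_iff polys_mult simp flip: i_mult)
next
  case (step k)
  interpret E: skew_extension U "W (Suc k)" "i ` polys n" "j (\<alpha> k)" "i (Var k)" "i (\<alpha> k (Var k))"
    by (rule skew_extension_W) (use step in simp)
  show ?case
  proof (rule E.regular_extend)
    show "w \<in> generate_ring U (insert (j (\<alpha> k)) (W (Suc k)))"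
      using W_subset_generate step by blast
    show "w' = \<zero>" if "w' \<in> W (Suc k)" "[Suc m] \<cdot> (w' \<otimes> i (\<alpha> k (Var k))) = \<zero>" for m w'
    proof (rule scaled_regular[OF _ _ _ that])
      show "v = \<zero>" if "h \<in> polys n" "h \<noteq> 0" "v \<in> W (Suc k)" "v \<otimes> i h = \<zero>" for h v
        by (rule step.IH[OF that])
    qed (use step.hyps diagonal \<alpha>_L in \<open>auto simp: polys_Var\<close>)
    show "w' = \<zero>" if "w' \<in> W (Suc k)" "w' \<otimes> i g = \<zero>" for w'
      by (rule step.IH[OF step.prems(1,2) that])
  qed (use step.prems in auto)
qed

text \<open>Starting from \<open>W 0\<close>, which is all of \<open>U\<close>, commuting with
  \<open>x_k\<close> lets a central element descend from \<open>W k\<close> to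
  \<open>W (Suc k)\<close>.\<close>

lemma center_in_W:
  assumes z: "z \<in> ring_center U" and "k \<le> n"
  shows "z \<in> W k"
  using \<open>k \<le> n\<close>
proof (induction k)
  case 0
  then show ?case using z by (simp add: W_0 ring_center_def)
next
  case (Suc k)
  interpret E: skew_extension U "W (Suc k)" "i ` polys n" "j (\<alpha> k)" "i (Var k)" "i (\<alpha> k (Var k))"
    by (rule skew_extension_W) (use Suc in simp)
  show ?case
  proof (rule E.commuting_in_W)
    show "z \<in> generate_ring U (insert (j (\<alpha> k)) (W (Suc k)))"
      using subsetD[OF W_subset_generate[of k]] Suc by simp
    show "z \<otimes> i (Var k) = i (Var k) \<otimes> z"
      using z Suc.prems by (simp add: ring_center_def polys_Var)
    show "w = \<zero>" if "w \<in> W (Suc k)" "[Suc m] \<cdot> (w \<otimes> i (\<alpha> k (Var k))) = \<zero>" for m w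
      using scaled_regular[OF W_regular[OF Suc.prems] _ _ that] diagonal \<alpha>_L Suc.prems
      by (simp add: polys_Var)
  qed
qed

lemma center_eq: "ring_center U = i ` range Const"
proof
  show "ring_center U \<subseteq> i ` range Const"
  proof
    fix z assume z: "z \<in> ring_center U"
    then obtain s where s: "s \<in> polys n" "z = i s"
      using center_in_W[of z n] W_n by auto
    have \<alpha>_s: "\<alpha> l s = 0" if "l < n" for l
    proof -
      have "j (\<alpha> l) \<otimes> i s = i s \<otimes> j (\<alpha> l)"
        using z s \<alpha>_L[OF that] by (simp add: ring_center_def)
      then have "i s \<otimes> j (\<alpha> l) \<oplus> i (\<alpha> l s) = i s \<otimes> j (\<alpha> l)"
        using j_i_commute[OF \<alpha>_L[OF that] s(1)] by simp
      then have "i (\<alpha> l s) = \<zero>"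
        using s \<alpha>_L[OF that] by simp
      then show ?thesis
        using s \<alpha>_L[OF that] by (simp add: i_eq_0_iff)
    qed
    \<comment> \<open>The variables are removed from the last to the first: on polynomials in
      \<open>x_0, ..., x_m\<close> the derivation \<open>\<alpha> m\<close> is a nonzero multiple of
      the partial derivative in \<open>x_m\<close>, so \<open>derivation_kernel\<close> eliminates
      \<open>x_m\<close>.\<close>
    have "s \<in> polys m" if "m \<le> n" for m
      using that
    proof (induction m rule: inc_induct)
      case base
      then show ?case by (rule s)
    next
      case (step m)
      then show ?case
        using derivation_kernel[OF derivation[OF \<alpha>_L], of m m s] triangular diagonal \<alpha>_s by simp
    qed
    then show "z \<in> i ` range Const"
      using polys_0_eq_Const[of s] s by blast
  qed
  show "i ` range Const \<subseteq> ring_center U"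
  proof clarify
    fix c :: 'k
    \<comment> \<open>Since \<open>W 0\<close> is the whole of \<open>U\<close>, commutation can be
      tested on generators; derivations kill constants.\<close>
    have "i (Const c) \<otimes> u = u \<otimes> i (Const c)" if "u \<in> W 0" for u
      using that
    proof (induction rule: W_induct)
      case (poly s)
      then show ?case by (simp add: mult.commute flip: i_mult)
    next
      case (der l)
      then have "\<alpha> l (Const c) = 0"
        using derivation \<alpha>_L by (simp add: is_derivation_def)
      then show ?case using der \<alpha>_L by (simp add: j_i_commute i_0)
    next
      case (mult u v)
      have carr: "u \<in> carrier U" "v \<in> carrier U"
        using mult.hyps W_carrier by auto
      then have "i (Const c) \<otimes> (u \<otimes> v) = u \<otimes> i (Const c) \<otimes> v"
        by (simp add: mult.IH(1) flip: m_assoc)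
      then show ?case
        using carr by (simp add: m_assoc mult.IH(2))
    qed (simp_all add: l_minus r_minus l_distr r_distr W_0)
    then show "i (Const c) \<in> ring_center U"
      by (simp add: ring_center_def W_0)
  qed
qed

end

theorem theorem3p4:
  fixes n :: nat
    and L :: "('k::field_char_0 mpoly \<Rightarrow> 'k mpoly) set"
    and U :: "'u ring"
    and i :: "'k mpoly \<Rightarrow> 'u"
    and j :: "('k mpoly \<Rightarrow> 'k mpoly) \<Rightarrow> 'u"
  assumes "1 \<le> n"
    and "triangularizable n L"
    and "is_UEA n L U i j"
  shows "ring_center U = i ` (Const ` UNIV)"
proof -
  have L: "LR_subalgebra n L"
    using assms(2) by (simp add: triangularizable_def)
  obtain \<alpha> where \<alpha>: "\<forall>l<n. \<alpha> l \<in> L"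
    and basis: "\<forall>D\<in>L. \<exists>!c. (\<forall>l. n \<le> l \<longrightarrow> c l = 0) \<and> (\<forall>l<n. c l \<in> polys n) \<and>
      D = (\<lambda>p. \<Sum>l<n. der_smult n (c l) (\<alpha> l) p)"
    and triangular: "\<forall>l<n. \<forall>m<n. m < l \<longrightarrow> \<alpha> l (Var m) = 0"
    and diagonal: "(\<Prod>l<n. \<alpha> l (Var l)) \<noteq> 0"
    using assms(2) unfolding triangularizable_def by auto
  have span: "\<exists>c. (\<forall>l<n. c l \<in> polys n) \<and> D = (\<lambda>p. \<Sum>l<n. der_smult n (c l) (\<alpha> l) p)"
    if "D \<in> L" for D
    using ex1_implies_ex[OF bspec[OF basis that]] by blast
  interpret triangular_rep n L U i j \<alpha>
  proof
    show "LR_rep n L U i j"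
      using assms(3) by (simp add: is_UEA_def)
    show "inj_on i (polys n)"
      using UEA_inj[OF L _ span assms(3)] \<alpha> by blast
    show "carrier U = generate_ring U (i ` polys n \<union> j ` L)"
      by (rule UEA_generated[OF assms(3)])
    show "\<alpha> l (Var l) \<noteq> 0" if "l < n" for l
      using diagonal that by auto
  qed (use L \<alpha> span triangular in auto)
  show ?thesis
    by (rule center_eq)
qed

end
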